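(* Let $A\in\mathcal M_n(\mathbb C)$ and $1\le k\le n-1$. For the regions $\mathcal E_k(\cdot)$ of the complex plane defined in the context, the following hold: (i) $\sigma(A)\subset\mathcal E_k(A)$; (ii) $\mathcal E_k(\tilde U^*A\tilde U)=\mathcal E_k(A)$ if $\tilde U$ is unitary; (iii) $\mathcal E_k(A^T)=\mathcal E_k(A)$; (iv) $\mathcal E_k(A^* )=\overline{\mathcal E_k(A)}$, where $\overline{\mathcal E}=\{\bar z: z\in\mathcal E\}$; (v) $\mathcal E_k(aA+bI_n)=a\,\mathcal E_k(A)+b$ if $a,b\in\mathbb C$, where $a\mathcal E+b=\{az+b: z\in\mathcal E\}$; (vi) $\Lambda_{k+1}(A)\subset\mathcal E_k(A)$, where $\Lambda_{k+1}(A)$ is the $(k+1)$-rank numerical range of $A$.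
   Context: $\mathcal M_{n,k}(\mathbb C)$ is the space of complex $n\times k$ matrices and $\mathcal M_n(\mathbb C)=\mathcal M_{n,n}(\mathbb C)$. For a square complex matrix $B$, $B^*$ is the conjugate transpose, $H(B)=\frac12(B+B^* )$ is the Hermitian part, $S(B)=\frac12(B-B^* )$ is the skew-Hermitian part, $\sigma(B)$ is the spectrum, and $\mathrm{adj}(B)$ is the adjugate (equal to $1$ for a $1\times 1$ matrix). $\lambda_{\max}$ denotes the largest eigenvalue of a Hermitian matrix and $\sigma_1$ the largest singular value. Construction. For $B\in\mathcal M_n(\mathbb C)$ let $\delta_1(B)\ge\dots\ge\delta_n(B)$ be the eigenvalues of $H(B)$, with $\mathbf u_1,\dots,\mathbf u_n$ the corresponding normalized orthogonal eigenvectors, and let $U$ be the unitary matrix with columns $\mathbf u_j$, so $U^*H(B)U=\mathrm{diag}(\delta_1(B),\dots,\delta_n(B))$. Put $\Delta_k=\mathrm{diag}(\delta_1(B),\dots,\delta_k(B))$ and write $U^*S(B)U=\begin{pmatrix} Y_k & -V_k^* \\ V_k & \tilde Y_k \end{pmatrix}$ with $Y_k\in\mathcal M_k(\mathbb C)$ and $V_k\in\mathcal M_{n-k,k}(\mathbb C)$. For $\lambda\in\mathbb C$ put $W_k=\Delta_k+Y_k-\lambda I_k$. Let $$E_k(B)=\Big\{\lambda\in\mathbb C:\ |\det W_k|^2(\mathrm{Re}(\lambda)-\delta_{k+1}(B))\le(\sigma_1(V_k))^2\,\lambda_{\max}\big(H(\det W_k\,\mathrm{adj}(W_k^* ))\big)\Big\},$$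 and $$\mathcal E_k(A)=\bigcap_{\theta\in[0,2\pi)}e^{-i\theta}E_k(e^{i\theta}A),$$ where for each $\theta$ the set $E_k(e^{i\theta}A)$ is constructed from the matrix $B=e^{i\theta}A$. The $\ell$-rank numerical range of $A$ is $\Lambda_\ell(A)=\{\mu\in\mathbb C:\ X^*AX=\mu I_\ell\text{ for some }X\in\mathcal M_{n,\ell}(\mathbb C)\text{ with }X^*X=I_\ell\}=\bigcap_{\theta\in[0,2\pi)}e^{-i\theta}\{s+it: s,t\in\mathbb R,\ s\le\delta_\ell(e^{i\theta}A)\}$. *)

theory Defs
  imports
    "HOL-Computational_Algebra.Computational_Algebra"
    "Jordan_Normal_Form.Schur_Decomposition"
    "Jordan_Normal_Form.Spectral_Radius"
begin

definition unitary_mat :: "nat \<Rightarrow> complex mat \<Rightarrow> bool" where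
  "unitary_mat n U \<longleftrightarrow> U \<in> carrier_mat n n \<and> mat_adjoint U * U = 1\<^sub>m n"

definition herm_part :: "complex mat \<Rightarrow> complex mat" where
  "herm_part B = (1 / 2) \<cdot>\<^sub>m (B + mat_adjoint B)"

definition skew_part :: "complex mat \<Rightarrow> complex mat" where
  "skew_part B = (1 / 2) \<cdot>\<^sub>m (B - mat_adjoint B)"

(* Only meant for Hermitian M, whose spectrum is real. *)
definition lambda_max :: "complex mat \<Rightarrow> real" where
  "lambda_max M = Max (Re ` spectrum M)"

(* For a rectangular M the matrix M^* M may have additional eigenvalues 0, which do not
   affect the maximum of the square roots. *)
definition sigma1 :: "complex mat \<Rightarrow> real" where
  "sigma1 M = Max ((\<lambda>x. sqrt (Re x)) ` spectrum (mat_adjoint M * M))"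

(* The j-th largest eigenvalue of the Hermitian part, counted with multiplicity, for
   j = 1, ..., n; hence the shift to the 0-based list index. *)
definition delta :: "complex mat \<Rightarrow> nat \<Rightarrow> real" where
  "delta B j =
     rev (sorted_list_of_multiset (image_mset Re (proots (char_poly (herm_part B))))) ! (j - 1)"

(* All matrices U whose columns are orthonormal eigenvectors of the Hermitian part of B,
   listed in the order of the eigenvalues delta B 1 \<ge> ... \<ge> delta B n.  If B has size n,
   such a U exists by the spectral theorem but is never unique. *)
definition eigenframes :: "complex mat \<Rightarrow> complex mat set" where
  "eigenframes B =
     {U. unitary_mat (dim_row B) U \<and>
         mat_adjoint U * herm_part B * U
           = mat_diag (dim_row B) (\<lambda>j. complex_of_real (delta B (j + 1)))}"

definition skew_conj :: "complex mat \<Rightarrow> complex mat \<Rightarrow> complex mat" where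
  "skew_conj B U = mat_adjoint U * skew_part B * U"

definition Y_block :: "nat \<Rightarrow> complex mat \<Rightarrow> complex mat \<Rightarrow> complex mat" where
  "Y_block k B U = mat k k (\<lambda>(i, j). skew_conj B U $$ (i, j))"

definition V_block :: "nat \<Rightarrow> complex mat \<Rightarrow> complex mat \<Rightarrow> complex mat" where
  "V_block k B U = mat (dim_row B - k) k (\<lambda>(i, j). skew_conj B U $$ (k + i, j))"

definition W_mat :: "nat \<Rightarrow> complex mat \<Rightarrow> complex mat \<Rightarrow> complex \<Rightarrow> complex mat" where
  "W_mat k B U z =
     mat_diag k (\<lambda>j. complex_of_real (delta B (j + 1))) + Y_block k B U - z \<cdot>\<^sub>m 1\<^sub>m k"

(* The region E_k(B), computed with the eigenvectors U.  The choice of U matters if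
   delta B k = delta B (k + 1), so U is an explicit argument. *)
definition E_region :: "nat \<Rightarrow> complex mat \<Rightarrow> complex mat \<Rightarrow> complex set" where
  "E_region k B U =
     {z. (cmod (det (W_mat k B U z)))\<^sup>2 * (Re z - delta B (k + 1))
         \<le> (sigma1 (V_block k B U))\<^sup>2 *
           lambda_max (herm_part
             (det (W_mat k B U z) \<cdot>\<^sub>m adj_mat (mat_adjoint (W_mat k B U z))))}"

(* The intersection over all rotations, where U t is the choice of eigenvectors
   made for the matrix exp(i t) A. *)
definition Ecal :: "nat \<Rightarrow> complex mat \<Rightarrow> (real \<Rightarrow> complex mat) \<Rightarrow> complex set" where
  "Ecal k A U =
     (\<Inter>t\<in>{0..<2 * pi}. (\<lambda>z. cis (- t) * z) ` E_region k (cis t \<cdot>\<^sub>m A) (U t))"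

(* The region above is determined by A only up to the choice of the eigenvectors: if the
   k-th and (k+1)-st eigenvalues coincide for some rotation, different choices can give
   different regions.  This is the set of all values that the construction can take;
   it is never empty for square A, by the spectral theorem. *)
definition Ecals :: "nat \<Rightarrow> complex mat \<Rightarrow> complex set set" where
  "Ecals k A =
     {Ecal k A U | U. \<forall>t\<in>{0..<2 * pi}. U t \<in> eigenframes (cis t \<cdot>\<^sub>m A)}"

definition rank_numerical_range :: "nat \<Rightarrow> complex mat \<Rightarrow> complex set" where
  "rank_numerical_range l A =
     {z. \<exists>X\<in>carrier_mat (dim_row A) l.
           mat_adjoint X * X = 1\<^sub>m l \<and> mat_adjoint X * A * X = z \<cdot>\<^sub>m 1\<^sub>m l}"

end

theory Submission
  imports Defs
begin

text \<open>
Write \<open>B = e\<^sup>i\<^sup>\<theta> A\<close>, let \<open>\<delta>\<^sub>1 \<ge> \<dots> \<ge> \<delta>\<^sub>n\<close> be the eigenvalues of its Hermitian part \<open>H(B)\<close>, and pass to the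
orthonormal eigenvectors of \<open>H(B)\<close>.  In these coordinates \<open>B\<close> becomes
\<open>diag(\<delta>\<^sub>1, \<dots>, \<delta>\<^sub>n)\<close> plus a skew-Hermitian matrix; \<open>W\<close> is the leading \<open>k\<close> by \<open>k\<close> block minus \<open>\<lambda>\<close>,
and \<open>V\<close>, \<open>-V\<^sup>*\<close> are the off-diagonal blocks.  If \<open>W\<close> is singular, both sides of the
inequality that defines \<open>E\<^sub>k(B)\<close> vanish.  If \<open>W\<close> is invertible, dividing by \<open>|det W|\<^sup>2\<close> turns the inequality
into \<open>Re \<lambda> - \<delta>\<^sub>k\<^sub>+\<^sub>1 \<le> \<sigma>\<^sub>1(V)\<^sup>2 \<lambda>\<^sub>m\<^sub>a\<^sub>x(H(W\<^sup>-\<^sup>1))\<close>.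

Two facts about this inequality carry the inclusions.  Since \<open>H(W) = diag(\<delta>\<^sub>j - Re \<lambda>)\<close>, the
number \<open>\<lambda>\<^sub>m\<^sub>a\<^sub>x(H(W\<^sup>-\<^sup>1))\<close> is nonnegative as soon as \<open>Re \<lambda> \<le> \<delta>\<^sub>1\<close> (\<open>lambda_max_W_mat_nonneg\<close>).
Hence the half-plane \<open>Re \<lambda> \<le> \<delta>\<^sub>k\<^sub>+\<^sub>1\<close> lies in \<open>E\<^sub>k(B)\<close> (\<open>halfplane_subset_E_region\<close>), and the
rank numerical range lies in it because a compression of \<open>B\<close> to a space of dimension \<open>k + 1\<close>
meets the span of the eigenvectors of \<open>\<delta>\<^sub>k\<^sub>+\<^sub>1, \<dots>, \<delta>\<^sub>n\<close> (\<open>compression_le_delta\<close>).  For an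
eigenvalue \<open>\<lambda>\<close> with eigenvector \<open>(y\<^sub>1, y\<^sub>2)\<close> the first block row says \<open>W y\<^sub>1 = V\<^sup>* y\<^sub>2\<close>, and the
real part of the eigenvalue equation paired with the eigenvector says
\<open>\<Sum>\<^sub>j (\<delta>\<^sub>j - Re \<lambda>) |y\<^sub>j|\<^sup>2 = 0\<close>.  In particular \<open>Re \<lambda> \<le> \<delta>\<^sub>1\<close>, so the nonnegativity applies.  The part of
the sum with \<open>j \<le> k\<close> is \<open>Re \<langle>W y\<^sub>1, y\<^sub>1\<rangle>\<close>, which is at most
\<open>\<lambda>\<^sub>m\<^sub>a\<^sub>x(H(W\<^sup>-\<^sup>1)) |V\<^sup>* y\<^sub>2|\<^sup>2\<close> and hence at most \<open>\<lambda>\<^sub>m\<^sub>a\<^sub>x(H(W\<^sup>-\<^sup>1)) \<sigma>\<^sub>1(V)\<^sup>2 |y\<^sub>2|\<^sup>2\<close>; the rest is at most \<open>(\<delta>\<^sub>k\<^sub>+\<^sub>1 - Re \<lambda>) |y\<^sub>2|\<^sup>2\<close>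
(\<open>spectrum_subset_E_region\<close>).

The equivariance statements hold because each operation on \<open>A\<close> permutes the rotations and
carries every eigenframe of a rotated matrix to an eigenframe of the new one, while \<open>W\<close> becomes
\<open>W\<close>, its transpose, its adjoint or a positive multiple, and \<open>V\<close> keeps its singular values up to the same factor
(\<open>Ecals_transport\<close> and the four lemmas on a single region).  For an
operation with an inverse of the same kind one inclusion suffices.  Only \<open>z \<mapsto> 0 z + b\<close> has
none; there the region for each rotation lies in the half-plane to the left of the rotated
point, so the intersection is \<open>{b}\<close>, and it remains to know that the regions of \<open>A\<close> exist,
which is the spectral theorem, and are nonempty, which follows from the spectral inclusion.
\<close>

section \<open>Adjoints and the complex inner product\<close>

lemma dim_mat_adjoint [simp]:
  "dim_row (mat_adjoint M) = dim_col M" "dim_col (mat_adjoint M) = dim_row M"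
  by (simp_all add: mat_adjoint_def)

lemma index_mat_adjoint [simp]:
  fixes M :: "complex mat"
  assumes "i < dim_col M" "j < dim_row M"
  shows "mat_adjoint M $$ (i, j) = cnj (M $$ (j, i))"
  using assms by (simp add: mat_adjoint_def mat_of_rows_def)

lemma mat_adjoint_carrier [simp]:
  "M \<in> carrier_mat m n \<Longrightarrow> mat_adjoint M \<in> carrier_mat n m"
  unfolding carrier_mat_def by simp

lemma mat_adjoint_adjoint [simp]: "mat_adjoint (mat_adjoint M) = (M :: complex mat)"
  by (rule eq_matI) auto

lemma mat_adjoint_smult: "mat_adjoint (c \<cdot>\<^sub>m M) = cnj c \<cdot>\<^sub>m mat_adjoint (M :: complex mat)"
  by (rule eq_matI) auto

lemma mat_adjoint_one [simp]: "mat_adjoint (1\<^sub>m n :: complex mat) = 1\<^sub>m n"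
  by (rule eq_matI) auto

lemma mat_adjoint_mult:
  fixes M N :: "complex mat"
  assumes "M \<in> carrier_mat l m" "N \<in> carrier_mat m n"
  shows "mat_adjoint (M * N) = mat_adjoint N * mat_adjoint M"
  using assms by (intro eq_matI) (auto simp: scalar_prod_def mult.commute intro!: sum.cong)

lemma mat_adjoint_transpose: "mat_adjoint (transpose_mat M) = transpose_mat (mat_adjoint (M :: complex mat))"
  by (rule eq_matI) auto

lemma transpose_mat_adjoint: "transpose_mat (mat_adjoint M) = map_mat cnj (M :: complex mat)"
  by (rule eq_matI) auto

text \<open>
The library pairing \<open>u \<bullet>c v\<close> conjugates its second argument; moving a matrix across it is the
one property of the adjoint from which all estimates below are derived.
\<close>

lemma cscalar_mat_adjoint:
  fixes M :: "complex mat"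
  assumes M: "M \<in> carrier_mat m n" and u: "u \<in> carrier_vec n" and v: "v \<in> carrier_vec m"
  shows "(M *\<^sub>v u) \<bullet>c v = u \<bullet>c (mat_adjoint M *\<^sub>v v)"
proof -
  have "(M *\<^sub>v u) \<bullet>c v = (\<Sum>i<m. \<Sum>j<n. M $$ (i, j) * u $ j * cnj (v $ i))"
    using assms by (auto simp: scalar_prod_def atLeast0LessThan sum_distrib_right intro!: sum.cong)
  also have "\<dots> = (\<Sum>j<n. \<Sum>i<m. M $$ (i, j) * u $ j * cnj (v $ i))"
    by (rule sum.swap)
  also have "\<dots> = u \<bullet>c (mat_adjoint M *\<^sub>v v)"
    using assms
    by (auto simp: scalar_prod_def atLeast0LessThan sum_distrib_left mult_ac intro!: sum.cong)
  finally show ?thesis .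
qed

lemma Re_cscalar_self:
  fixes v :: "complex vec"
  assumes "v \<in> carrier_vec n"
  shows "Re (v \<bullet>c v) = (\<Sum>i<n. (cmod (v $ i))\<^sup>2)"
  using assms by (auto simp: scalar_prod_def atLeast0LessThan cmod_power2 sum.distrib simp flip: power2_eq_square)

lemma Re_cscalar_self_nonneg: "0 \<le> Re ((v :: complex vec) \<bullet>c v)"
  by (subst Re_cscalar_self[OF carrier_vec_dim_vec]) (simp add: sum_nonneg)

lemma Re_cscalar_self_pos:
  assumes "v \<in> carrier_vec n" "v \<noteq> 0\<^sub>v n"
  shows "0 < Re ((v :: complex vec) \<bullet>c v)"
  using assms conjugate_square_greater_0_vec[OF assms(1)] by (simp add: less_complex_def)

lemma Re_cscalar_swap:
  fixes u v :: "complex vec"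
  assumes "u \<in> carrier_vec n" "v \<in> carrier_vec n"
  shows "Re (u \<bullet>c v) = Re (v \<bullet>c u)"
  using assms by (auto simp: scalar_prod_def mult.commute intro!: sum.cong)

section \<open>Unitary matrices, Hermitian and skew-Hermitian parts\<close>

lemma unitary_matD:
  assumes "unitary_mat n U"
  shows "U \<in> carrier_mat n n" "mat_adjoint U \<in> carrier_mat n n"
    "mat_adjoint U * U = 1\<^sub>m n" "U * mat_adjoint U = 1\<^sub>m n"
  using assms mat_mult_left_right_inverse[of "mat_adjoint U" n U]
  by (auto simp: unitary_mat_def)

lemma unitary_mat_adjoint:
  assumes "unitary_mat n U"
  shows "unitary_mat n (mat_adjoint U)"
  using unitary_matD[OF assms] by (simp add: unitary_mat_def)

lemma unitary_mat_mult:
  assumes "unitary_mat n U" "unitary_mat n V"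
  shows "unitary_mat n (U * V)"
proof -
  note U = unitary_matD[OF assms(1)] and V = unitary_matD[OF assms(2)]
  have "mat_adjoint (U * V) * (U * V) = mat_adjoint V * (mat_adjoint U * U) * V"
    using U(1,2) V(1,2) by (simp add: mat_adjoint_mult[of _ n n _ n] assoc_mult_mat[of _ n n _ n _ n] mult_carrier_mat[of _ n n _ n])
  then show ?thesis using U V by (simp add: unitary_mat_def)
qed

lemma cscalar_unitary:
  assumes "unitary_mat n U" "u \<in> carrier_vec n" "v \<in> carrier_vec n"
  shows "(U *\<^sub>v u) \<bullet>c (U *\<^sub>v v) = u \<bullet>c v"
  using assms unitary_matD[OF assms(1)]
  by (simp add: cscalar_mat_adjoint[of _ n n] flip: assoc_mult_mat_vec[of _ n n _ n])

lemma herm_part_carrier [simp]: "B \<in> carrier_mat n n \<Longrightarrow> herm_part B \<in> carrier_mat n n"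
  by (auto simp: herm_part_def)

lemma skew_part_carrier [simp]: "B \<in> carrier_mat n n \<Longrightarrow> skew_part B \<in> carrier_mat n n"
  unfolding skew_part_def by (intro smult_carrier_mat minus_carrier_mat) simp

lemma index_herm_part:
  assumes "B \<in> carrier_mat n n" "i < n" "j < n"
  shows "herm_part B $$ (i, j) = (B $$ (i, j) + cnj (B $$ (j, i))) / 2"
  using assms by (simp add: herm_part_def)

lemma index_skew_part:
  assumes "B \<in> carrier_mat n n" "i < n" "j < n"
  shows "skew_part B $$ (i, j) = (B $$ (i, j) - cnj (B $$ (j, i))) / 2"
  using assms by (simp add: skew_part_def)

lemma herm_plus_skew:
  assumes "B \<in> carrier_mat n n"
  shows "herm_part B + skew_part B = B"
  using assms carrier_matD[OF skew_part_carrier[OF assms]]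
  by (intro eq_matI) (auto simp: index_herm_part index_skew_part diff_divide_distrib add_divide_distrib)

lemma mat_adjoint_herm_part:
  assumes "B \<in> carrier_mat n n"
  shows "mat_adjoint (herm_part B) = herm_part B"
  using assms carrier_matD[OF herm_part_carrier[OF assms]]
  by (intro eq_matI) (auto simp: index_herm_part add.commute)

lemma mat_adjoint_skew_part:
  assumes "B \<in> carrier_mat n n"
  shows "mat_adjoint (skew_part B) = (- 1) \<cdot>\<^sub>m skew_part B"
  using assms carrier_matD[OF skew_part_carrier[OF assms]]
  by (intro eq_matI) (auto simp: index_skew_part minus_divide_left)

text \<open>
With the companion rule for skew-Hermitian parts this shows that a matrix written
in the orthonormal eigenvectors of its Hermitian part is a real diagonal matrix plus a skew-Hermitian one.
\<close>

lemma herm_part_conj: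
  assumes "B \<in> carrier_mat n n" "P \<in> carrier_mat n n"
  shows "herm_part (mat_adjoint P * B * P) = mat_adjoint P * herm_part B * P"
proof -
  have "mat_adjoint (mat_adjoint P * B * P) = mat_adjoint P * mat_adjoint B * P"
    using assms by (simp add: mat_adjoint_mult[of _ n n _ n] assoc_mult_mat[of _ n n _ n _ n] mult_carrier_mat[of _ n n _ n])
  then show ?thesis using assms unfolding herm_part_def
    by (simp add: mult_smult_distrib[of _ n n _ n] mult_smult_assoc_mat[of _ n n _ n] mult_carrier_mat[of _ n n _ n]
        mult_add_distrib_mat[of _ n n _ n] add_mult_distrib_mat[of _ n n _ _ n])
qed

lemma skew_part_conj:
  assumes "B \<in> carrier_mat n n" "P \<in> carrier_mat n n"
  shows "skew_part (mat_adjoint P * B * P) = mat_adjoint P * skew_part B * P"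
proof -
  have "mat_adjoint (mat_adjoint P * B * P) = mat_adjoint P * mat_adjoint B * P"
    using assms by (simp add: mat_adjoint_mult[of _ n n _ n] assoc_mult_mat[of _ n n _ n _ n] mult_carrier_mat[of _ n n _ n])
  then show ?thesis using assms unfolding skew_part_def
    by (simp add: mult_smult_distrib[of _ n n _ n] mult_smult_assoc_mat[of _ n n _ n] mult_carrier_mat[of _ n n _ n] minus_carrier_mat
        mult_minus_distrib_mat[of _ n n _ n] minus_mult_distrib_mat[of _ n n _ _ n])
qed

text \<open>
The skew-Hermitian part contributes a purely imaginary number to the quadratic form.
\<close>

lemma Re_cscalar_herm_part:
  assumes B: "B \<in> carrier_mat n n" and v: "v \<in> carrier_vec n"
  shows "Re ((herm_part B *\<^sub>v v) \<bullet>c v) = Re ((B *\<^sub>v v) \<bullet>c v)"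
proof -
  have "herm_part B *\<^sub>v v = (1 / 2) \<cdot>\<^sub>v (B *\<^sub>v v + mat_adjoint B *\<^sub>v v)"
    using B v by (intro eq_vecI) (auto simp: herm_part_def scalar_prod_def sum.distrib
        algebra_simps sum_distrib_left sum_divide_distrib simp del: One_nat_def intro!: sum.cong)
  then have half: "(herm_part B *\<^sub>v v) \<bullet>c v = ((B *\<^sub>v v) \<bullet>c v + (mat_adjoint B *\<^sub>v v) \<bullet>c v) / 2"
    using B v add_scalar_prod_distrib[of "B *\<^sub>v v" n "mat_adjoint B *\<^sub>v v" "conjugate v"]
      mult_mat_vec_carrier[OF mat_adjoint_carrier[OF B] v]
    by simp
  have swap: "Re ((mat_adjoint B *\<^sub>v v) \<bullet>c v) = Re ((B *\<^sub>v v) \<bullet>c v)"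
    using B v cscalar_mat_adjoint[of "mat_adjoint B" n n v v]
    by (simp add: Re_cscalar_swap[of "B *\<^sub>v v" n v])
  show ?thesis using arg_cong[OF half, of Re] swap by simp
qed

section \<open>The spectral theorem for Hermitian matrices\<close>

text \<open>
Gram-Schmidt produces columns that are orthogonal but not of length one; the lengths are
corrected by a diagonal factor on the right.
\<close>

lemma unitary_normalized_columns:
  fixes W :: "complex mat"
  assumes W: "W \<in> carrier_mat n n" and orth: "corthogonal_mat W"
  defines "c \<equiv> (\<lambda>j. complex_of_real (1 / sqrt (Re (col W j \<bullet>c col W j))))"
  shows "unitary_mat n (W * mat_diag n c)"
proof -
  have prod: "(mat_adjoint W * W) $$ (i, j) = col W j \<bullet>c col W i" if "i < n" "j < n" for i j
    using W that by (auto simp: scalar_prod_def mult.commute intro!: sum.cong)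
  have self: "col W j \<bullet>c col W j = complex_of_real (Re (col W j \<bullet>c col W j))"
    and pos: "0 < Re (col W j \<bullet>c col W j)" if "j < n" for j
  proof -
    have "col W j \<bullet>c col W j \<noteq> 0"
      using corthogonal_matD[OF orth, of j j] W that by simp
    then have "0 < col W j \<bullet>c col W j"
      using conjugate_square_ge_0_vec[of "col W j"] by (simp add: order.not_eq_order_implies_strict)
    then show "0 < Re (col W j \<bullet>c col W j)"
      and "col W j \<bullet>c col W j = complex_of_real (Re (col W j \<bullet>c col W j))"
      by (auto simp: less_complex_def complex_eq_iff)
  qed
  have "mat_adjoint (W * mat_diag n c) * (W * mat_diag n c)
      = mat_diag n c * (mat_adjoint W * W) * mat_diag n c"
  proof -
    have "mat_adjoint (mat_diag n c) = mat_diag n c"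
      by (rule eq_matI) (auto simp: mat_diag_def c_def)
    then show ?thesis using W mat_diag_dim[of n c]
      by (simp add: mat_adjoint_mult[of _ n n _ n] assoc_mult_mat[of _ n n _ n _ n]
          mult_carrier_mat[of _ n n _ n])
  qed
  also have "\<dots> = 1\<^sub>m n"
  proof (rule eq_matI)
    fix i j assume "i < dim_row (1\<^sub>m n :: complex mat)" "j < dim_col (1\<^sub>m n :: complex mat)"
    then have ij: "i < n" "j < n" by simp_all
    have "(mat_diag n c * (mat_adjoint W * W) * mat_diag n c) $$ (i, j)
        = c i * (mat_adjoint W * W) $$ (i, j) * c j"
      using W ij by (simp add: mat_diag_mult_left[of _ n n] mat_diag_mult_right[of _ n n]
          mult_carrier_mat[of _ n n _ n])
    also have "\<dots> = 1\<^sub>m n $$ (i, j)"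
    proof (cases "i = j")
      case True
      have "c j * c j = 1 / complex_of_real (Re (col W j \<bullet>c col W j))"
        using pos[OF ij(2)] unfolding c_def
        by (simp flip: of_real_mult)
      moreover have "complex_of_real (Re (col W j \<bullet>c col W j)) \<noteq> 0"
        using pos[OF ij(2)] by simp
      ultimately have "c j * (mat_adjoint W * W) $$ (j, j) * c j = 1"
        unfolding prod[OF ij(2) ij(2)] using self[OF ij(2)]
        by (metis (no_types, lifting) mult.commute mult.left_commute nonzero_eq_divide_eq times_divide_eq_right)
      then show ?thesis using True ij by simp
    next
      case False
      then show ?thesis using corthogonal_matD[OF orth, of j i] W ij prod[OF ij] by simp
    qed
    finally show "(mat_diag n c * (mat_adjoint W * W) * mat_diag n c) $$ (i, j) = 1\<^sub>m n $$ (i, j)" .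
  qed (use W in \<open>auto simp: mat_diag_def\<close>)
  finally show ?thesis using W by (simp add: unitary_mat_def mult_carrier_mat[of _ n n _ n])
qed

text \<open>
Every nonzero vector is, up to scaling, the first column of a unitary matrix: complete it to a
basis and orthogonalise, which leaves the first vector alone.
\<close>

lemma unitary_first_column:
  fixes v :: "complex vec"
  assumes v: "v \<in> carrier_vec n" and v0: "v \<noteq> 0\<^sub>v n" and n: "0 < n"
  shows "\<exists>U c. unitary_mat n U \<and> c \<noteq> 0 \<and> col U 0 = c \<cdot>\<^sub>v v"
proof -
  interpret cof_vec_space n "TYPE(complex)" .
  define b where "b = basis_completion v"
  define ws where "ws = gram_schmidt n b"
  define W where "W = mat_of_cols n ws"
  from basis_completion[OF v v0, folded b_def]
  have dist_b: "distinct b" and indep: "\<not> lin_dep (set b)" and b: "set b \<subseteq> carrier_vec n"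
    and hdb: "hd b = v" and len_b: "length b = n" by auto
  from hdb len_b n obtain vs where bv: "b = v # vs" by (cases b) auto
  from gram_schmidt_result[OF b dist_b indep refl, folded ws_def]
  have ws: "set ws \<subseteq> carrier_vec n" "corthogonal ws" "length ws = n"
    by (auto simp: len_b)
  have hdws: "hd ws = v" using gram_schmidt_hd[OF v, of vs, folded bv] by (simp add: ws_def)
  have orth: "corthogonal_mat W"
    using orthogonal_mat_of_cols ws unfolding W_def .
  have W: "W \<in> carrier_mat n n"
    using ws unfolding W_def using mat_of_cols_carrier(1)[of n ws] by auto
  have colW: "col W 0 = v"
    using ws hdws n unfolding W_def by (cases ws) (auto simp: col_mat_of_cols)
  define c where "c = (\<lambda>j. complex_of_real (1 / sqrt (Re (col W j \<bullet>c col W j))))"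
  have "unitary_mat n (W * mat_diag n c)"
    unfolding c_def by (rule unitary_normalized_columns[OF W orth])
  moreover have "c 0 \<noteq> 0"
    using Re_cscalar_self_pos[OF v v0] by (simp add: c_def colW)
  moreover have "col (W * mat_diag n c) 0 = c 0 \<cdot>\<^sub>v v"
    using W n v by (intro eq_vecI) (auto simp: mat_diag_mult_right[of _ n n] simp flip: colW)
  ultimately show ?thesis by blast
qed

lemma unitary_four_block:
  assumes "unitary_mat m V"
  shows "unitary_mat (Suc m) (four_block_mat (1\<^sub>m 1) (0\<^sub>m 1 m) (0\<^sub>m m 1) V)"
proof -
  note V = unitary_matD[OF assms]
  let ?V = "four_block_mat (1\<^sub>m 1) (0\<^sub>m 1 m) (0\<^sub>m m 1) V"
  have adj: "mat_adjoint ?V = four_block_mat (1\<^sub>m 1) (0\<^sub>m 1 m) (0\<^sub>m m 1) (mat_adjoint V)"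
    using V(1) by (intro eq_matI) auto
  have "mat_adjoint ?V * ?V = four_block_mat (1\<^sub>m 1) (0\<^sub>m 1 m) (0\<^sub>m m 1) (1\<^sub>m m)"
    unfolding adj using V by (subst mult_four_block_mat[of _ 1 1 _ m _ m _ _ 1 _ m]) auto
  also have "\<dots> = 1\<^sub>m (Suc m)"
    by (rule eq_matI) auto
  finally show ?thesis using V(1) four_block_carrier_mat[of "1\<^sub>m 1" 1 1 V m m] by (simp add: unitary_mat_def)
qed

text \<open>
Induction on the size.  A unitary \<open>W\<close> whose first column is an eigenvector brings \<open>H\<close> to a form
with first column \<open>(e, 0, \<dots>, 0)\<close>; as the result is again Hermitian, its first row is the same, \<open>e\<close>
is real, and the remaining block is a smaller Hermitian matrix.
\<close>

lemma hermitian_unitarily_diagonalizable: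
  assumes "H \<in> carrier_mat n n" "mat_adjoint H = H"
  shows "\<exists>U d. unitary_mat n U \<and> mat_adjoint U * H * U = mat_diag n (\<lambda>j. complex_of_real (d j))"
  using assms
proof (induction n arbitrary: H)
  case 0
  then show ?case by (intro exI[of _ "1\<^sub>m 0"] exI[of _ "\<lambda>_. 0"])
      (auto simp: unitary_mat_def mat_diag_def intro!: eq_matI)
next
  case (Suc m)
  let ?n = "Suc m"
  have H: "H \<in> carrier_mat ?n ?n" by fact
  obtain e v where ev: "v \<in> carrier_vec ?n" "v \<noteq> 0\<^sub>v ?n" "H *\<^sub>v v = e \<cdot>\<^sub>v v"
    using spectrum_non_empty[OF H] H by (auto simp: spectrum_def eigenvalue_def eigenvector_def)
  obtain W c where uW: "unitary_mat ?n W" and c: "c \<noteq> 0" "col W 0 = c \<cdot>\<^sub>v v"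
    using unitary_first_column[OF ev(1,2)] by auto
  note W = unitary_matD[OF uW]
  define M where "M = mat_adjoint W * H * W"
  have M: "M \<in> carrier_mat ?n ?n"
    using W H by (simp add: M_def mult_carrier_mat[of _ ?n ?n _ ?n])
  have adjM: "mat_adjoint M = M"
    using W H Suc.prems(2)
    by (simp add: M_def mat_adjoint_mult[of _ ?n ?n _ ?n] assoc_mult_mat[of _ ?n ?n _ ?n _ ?n]
        mult_carrier_mat[of _ ?n ?n _ ?n])
  have "col M 0 = mat_adjoint W *\<^sub>v (H *\<^sub>v col W 0)"
    using W H col_mult2[OF W(2) mult_carrier_mat[OF H W(1)], of 0] col_mult2[OF H W(1), of 0]
    by (simp only: M_def assoc_mult_mat[OF W(2) H W(1)] zero_less_Suc)
  also have "H *\<^sub>v col W 0 = e \<cdot>\<^sub>v col W 0"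
    using c ev H by (simp add: mult_mat_vec[of _ ?n ?n] smult_smult_assoc mult.commute)
  also have "mat_adjoint W *\<^sub>v (e \<cdot>\<^sub>v col W 0) = e \<cdot>\<^sub>v col (mat_adjoint W * W) 0"
    using mult_mat_vec[OF W(2) col_carrier_vec[OF _ W(1)], of 0 e] col_mult2[OF W(2) W(1), of 0]
    by (simp only: zero_less_Suc)
  finally have colM: "col M 0 = e \<cdot>\<^sub>v unit_vec ?n 0"
    using W(3) by simp
  have Mi0: "M $$ (i, 0) = (if i = 0 then e else 0)" if "i < ?n" for i
    using arg_cong[OF colM, of "\<lambda>u. vec_index u i"] M that by (auto simp: unit_vec_def)
  have M0i: "M $$ (0, i) = (if i = 0 then e else 0)" if "i < ?n" for i
    using index_mat_adjoint[of i M 0] Mi0[OF that] Mi0[of 0] adjM M that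
    by (metis carrier_matD complex_cnj_cancel_iff complex_cnj_zero index_mat_adjoint zero_less_Suc)
  have e_real: "e = complex_of_real (Re e)"
    using index_mat_adjoint[of 0 M 0] Mi0[of 0] adjM M
    by (simp add: complex_eq_iff)
  define K where "K = mat m m (\<lambda>(i, j). M $$ (Suc i, Suc j))"
  have K: "K \<in> carrier_mat m m" by (simp add: K_def)
  have adjK: "mat_adjoint K = K"
  proof (rule eq_matI)
    fix i j assume "i < dim_row K" "j < dim_col K"
    then have ij: "i < m" "j < m" using K by auto
    then show "mat_adjoint K $$ (i, j) = K $$ (i, j)"
      using index_mat_adjoint[of "Suc i" M "Suc j"] adjM M by (simp add: K_def)
  qed (use K in auto)
  let ?B = "\<lambda>X Y. four_block_mat X (0\<^sub>m 1 m) (0\<^sub>m m 1) Y"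
  have Mblock: "M = ?B (mat 1 1 (\<lambda>_. e)) K"
    using M by (intro eq_matI) (auto simp: K_def Mi0 M0i)
  obtain V d where V: "unitary_mat m V"
    and d: "mat_adjoint V * K * V = mat_diag m (\<lambda>j. complex_of_real (d j))"
    using Suc.IH[OF K adjK] by blast
  note V' = unitary_matD[OF V]
  let ?V = "?B (1\<^sub>m 1) V"
  note bV = unitary_matD[OF unitary_four_block[OF V]]
  have adjV: "mat_adjoint ?V = ?B (1\<^sub>m 1) (mat_adjoint V)"
    using V'(1) by (intro eq_matI) auto
  have "mat_adjoint ?V * M * ?V = ?B (mat 1 1 (\<lambda>_. e)) (mat_adjoint V * K * V)"
    unfolding adjV Mblock using V' K
    by (subst mult_four_block_mat[of _ 1 1 _ m _ m _ _ 1 _ m],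
        auto simp: mult_carrier_mat[of _ m m _ m] left_add_zero_mat[of _ m m])+
  also have "\<dots> = mat_diag ?n (\<lambda>j. complex_of_real (case j of 0 \<Rightarrow> Re e | Suc i \<Rightarrow> d i))"
    unfolding d using e_real by (intro eq_matI) (auto simp: mat_diag_def split: nat.splits)
  finally have "mat_adjoint (W * ?V) * H * (W * ?V)
      = mat_diag ?n (\<lambda>j. complex_of_real (case j of 0 \<Rightarrow> Re e | Suc i \<Rightarrow> d i))"
    using W bV H by (simp add: M_def mat_adjoint_mult[of _ ?n ?n _ ?n]
        assoc_mult_mat[of _ ?n ?n _ ?n _ ?n] mult_carrier_mat[of _ ?n ?n _ ?n])
  then show ?case
    using unitary_mat_mult[OF uW unitary_four_block[OF V]] by blast
qed

text \<open>
Permuting the eigenvectors by a sorting of the eigenvalues puts the diagonal in decreasing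
order.
\<close>

lemma spectral_decomposition_sorted:
  assumes "H \<in> carrier_mat n n" "mat_adjoint H = H"
  shows "\<exists>U d. unitary_mat n U \<and> antimono_on {..<n} d
    \<and> mat_adjoint U * H * U = mat_diag n (\<lambda>j. complex_of_real (d j))"
proof -
  obtain V d where V: "unitary_mat n V"
    and d: "mat_adjoint V * H * V = mat_diag n (\<lambda>j. complex_of_real (d j))"
    using hermitian_unitarily_diagonalizable[OF assms] by blast
  note V' = unitary_matD[OF V]
  \<comment> \<open>Sorting by the negated eigenvalues gives decreasing order.\<close>
  define p where "p = sort_key (\<lambda>i. - d i) [0..<n]"
  have len: "length p = n" by (simp add: p_def)
  have pn: "p ! i < n" if "i < n" for i
    using nth_mem[of i p] that len by (auto simp: p_def)
  have inj: "p ! i = p ! j \<longleftrightarrow> i = j" if "i < n" "j < n" for i j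
    using that len by (intro nth_eq_iff_index_eq) (auto simp: p_def)
  have "sorted (map (\<lambda>i. - d i) p)" by (simp add: p_def)
  then have mono: "antimono_on {..<n} (\<lambda>j. d (p ! j))"
    using len by (auto simp: monotone_on_def sorted_iff_nth_mono)
  define U where "U = mat n n (\<lambda>(i, j). V $$ (i, p ! j))"
  have U: "U \<in> carrier_mat n n" by (simp add: U_def)
  have conj: "(mat_adjoint U * X * U) $$ (i, j) = (mat_adjoint V * X * V) $$ (p ! i, p ! j)"
    if X: "X \<in> carrier_mat n n" and ij: "i < n" "j < n" for X i j
  proof -
    have "(mat_adjoint U * X) $$ (i, l) = (mat_adjoint V * X) $$ (p ! i, l)" if "l < n" for l
      using X ij that V'(1) pn[of i] by (auto simp: U_def scalar_prod_def intro!: sum.cong)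
    then show ?thesis
      using X ij V'(1) pn by (auto simp: U_def scalar_prod_def intro!: sum.cong simp del: index_mult_mat(1))
        (auto simp: scalar_prod_def)
  qed
  have "mat_adjoint U * 1\<^sub>m n * U = 1\<^sub>m n"
  proof (rule eq_matI)
    fix i j assume "i < dim_row (1\<^sub>m n :: complex mat)" "j < dim_col (1\<^sub>m n :: complex mat)"
    then show "(mat_adjoint U * 1\<^sub>m n * U) $$ (i, j) = 1\<^sub>m n $$ (i, j)"
      using V' pn inj by (simp add: conj del: index_mult_mat)
  qed (use U in auto)
  then have "unitary_mat n U" using U by (simp add: unitary_mat_def)
  moreover have "mat_adjoint U * H * U = mat_diag n (\<lambda>j. complex_of_real (d (p ! j)))"
  proof (rule eq_matI)
    fix i j assume "i < dim_row (mat_diag n (\<lambda>j. complex_of_real (d (p ! j))))"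
      "j < dim_col (mat_diag n (\<lambda>j. complex_of_real (d (p ! j))))"
    then have "i < n" "j < n" by (auto simp: mat_diag_def)
    then show "(mat_adjoint U * H * U) $$ (i, j) = mat_diag n (\<lambda>j. complex_of_real (d (p ! j))) $$ (i, j)"
      unfolding conj[OF assms(1) \<open>i < n\<close> \<open>j < n\<close>] d using pn inj by (simp add: mat_diag_def)
  qed (use U in \<open>auto simp: mat_diag_def\<close>)
  ultimately show ?thesis using mono by (intro exI[of _ U] exI[of _ "\<lambda>j. d (p ! j)"]) simp
qed

section \<open>Eigenframes and the ordered eigenvalues\<close>

lemma char_poly_unitary_conj:
  assumes U: "unitary_mat n U" and H: "H \<in> carrier_mat n n"
  shows "char_poly (mat_adjoint U * H * U) = char_poly H"
proof -
  note U' = unitary_matD[OF U]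
  have "similar_mat_wit (mat_adjoint U * H * U) H (mat_adjoint U) U"
    using U' H by (intro similar_mat_witI[of _ _ n]) (auto simp: mult_carrier_mat[of _ n n _ n])
  then show ?thesis
    by (intro char_poly_similar) (auto simp: similar_mat_def)
qed

text \<open>
A diagonal form displays the characteristic polynomial with multiplicities, and hence the
spectrum.
\<close>

lemma spectrum_unitary_diag:
  assumes U: "unitary_mat n U" and H: "H \<in> carrier_mat n n"
    and d: "mat_adjoint U * H * U = mat_diag n e"
  shows "char_poly H = (\<Prod>j\<leftarrow>[0..<n]. [:- e j, 1:])" "spectrum H = e ` {..<n}"
proof -
  have "char_poly H = char_poly (mat_diag n e)"
    using char_poly_unitary_conj[OF U H] d by simp
  also have "\<dots> = (\<Prod>a\<leftarrow>diag_mat (mat_diag n e). [:- a, 1:])"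
    by (rule char_poly_upper_triangular[of _ n]) (auto simp: upper_triangular_def mat_diag_def)
  also have "diag_mat (mat_diag n e) = map e [0..<n]"
    by (rule nth_equalityI) (auto simp: diag_mat_def mat_diag_def)
  finally show cp: "char_poly H = (\<Prod>j\<leftarrow>[0..<n]. [:- e j, 1:])"
    by (simp add: o_def)
  have "poly (char_poly H) x = 0 \<longleftrightarrow> x \<in> e ` {..<n}" for x
    unfolding cp by (auto simp: poly_prod_list prod_list_zero_iff o_def)
  then show "spectrum H = e ` {..<n}"
    unfolding spectrum_root_char_poly[OF H] by auto
qed

text \<open>
Recognises frames and computes \<open>delta\<close> at the same time: a decreasing diagonal form of the
Hermitian part has no choice but to list the ordered eigenvalues.  All transformation rules for
\<open>delta\<close> are read off from this lemma.
\<close>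

lemma eigenframesI:
  assumes B: "B \<in> carrier_mat n n" and U: "unitary_mat n U"
    and diag: "mat_adjoint U * herm_part B * U = mat_diag n (\<lambda>j. complex_of_real (d j))"
    and mono: "antimono_on {..<n} d"
  shows "U \<in> eigenframes B" "j < n \<Longrightarrow> delta B (Suc j) = d j"
proof -
  have "proots (\<Prod>j\<leftarrow>xs. [:- e j, 1:]) = mset (map e xs)" for e :: "nat \<Rightarrow> complex" and xs
  proof (induction xs)
    case (Cons x xs)
    have "(\<Prod>j\<leftarrow>xs. [:- e j, 1:]) \<noteq> 0"
      by (auto simp: prod_list_zero_iff)
    then show ?case using Cons by (simp add: proots_mult del: mult_pCons_left)
  qed simp
  then have "proots (char_poly (herm_part B)) = mset (map (\<lambda>j. complex_of_real (d j)) [0..<n])"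
    unfolding spectrum_unitary_diag(1)[OF U herm_part_carrier[OF B] diag] .
  then have "image_mset Re (proots (char_poly (herm_part B))) = mset (map d [0..<n])"
    by (simp add: multiset.map_comp o_def)
  moreover have "sort (map d [0..<n]) = rev (map d [0..<n])"
    using mono by (intro properties_for_sort)
      (auto simp: sorted_wrt_iff_nth_less rev_nth monotone_on_def)
  ultimately have "rev (sorted_list_of_multiset (image_mset Re (proots (char_poly (herm_part B)))))
      = map d [0..<n]"
    by (simp only: sorted_list_of_multiset_mset rev_rev_ident)
  then have d: "delta B (Suc j) = d j" if "j < n" for j
    using that by (simp add: delta_def)
  then show "j < n \<Longrightarrow> delta B (Suc j) = d j" by simp
  have "mat_diag n (\<lambda>j. complex_of_real (d j)) = mat_diag n (\<lambda>j. complex_of_real (delta B (j + 1)))"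
    by (rule eq_matI) (auto simp: mat_diag_def d)
  then show "U \<in> eigenframes B" using B U diag by (simp add: eigenframes_def)
qed

lemma eigenframesD:
  assumes "B \<in> carrier_mat n n" "U \<in> eigenframes B"
  shows "unitary_mat n U"
    "mat_adjoint U * herm_part B * U = mat_diag n (\<lambda>j. complex_of_real (delta B (Suc j)))"
  using assms by (auto simp: eigenframes_def)

lemma eigenframes_nonempty_delta_antimono:
  assumes B: "B \<in> carrier_mat n n"
  shows "eigenframes B \<noteq> {}" "antimono_on {..<n} (\<lambda>j. delta B (Suc j))"
proof -
  obtain U d where U: "unitary_mat n U" "antimono_on {..<n} d"
    "mat_adjoint U * herm_part B * U = mat_diag n (\<lambda>j. complex_of_real (d j))"
    using spectral_decomposition_sorted[OF herm_part_carrier[OF B] mat_adjoint_herm_part[OF B]] by blast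
  note * = eigenframesI[OF B U(1,3,2)]
  show "eigenframes B \<noteq> {}" using *(1) by blast
  show "antimono_on {..<n} (\<lambda>j. delta B (Suc j))"
    using U(2) *(2) by (auto simp: monotone_on_def)
qed

section \<open>Extremal eigenvalues and singular values\<close>

lemma mat_diag_mult_vec:
  fixes w :: "'a :: semiring_0 vec"
  assumes "w \<in> carrier_vec n"
  shows "mat_diag n e *\<^sub>v w = vec n (\<lambda>i. e i * w $ i)"
  using assms
  by (intro eq_vecI)
    (auto simp: mat_diag_def scalar_prod_def atLeast0LessThan if_distrib if_distribR sum.delta cong: if_cong)

lemma quadratic_mat_diag:
  assumes "y \<in> carrier_vec n"
  shows "Re ((mat_diag n (\<lambda>j. complex_of_real (d j)) *\<^sub>v y) \<bullet>c y) = (\<Sum>j<n. d j * (cmod (y $ j))\<^sup>2)"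
  unfolding mat_diag_mult_vec[OF assms] cmod_power2 using assms
  by (simp add: scalar_prod_def atLeast0LessThan power2_eq_square algebra_simps sum.distrib)

text \<open>
In orthonormal eigenvectors the quadratic form is a sum of eigenvalues weighted by squared
coordinates, and each of these eigenvalues is at most the largest one.
\<close>

lemma Rayleigh_bound:
  assumes M: "M \<in> carrier_mat m m" "mat_adjoint M = M" and v: "v \<in> carrier_vec m"
  shows "Re ((M *\<^sub>v v) \<bullet>c v) \<le> lambda_max M * Re (v \<bullet>c v)"
proof -
  obtain U d where U: "unitary_mat m U"
    and d: "mat_adjoint U * M * U = mat_diag m (\<lambda>j. complex_of_real (d j))"
    using hermitian_unitarily_diagonalizable[OF M] by blast
  note U' = unitary_matD[OF U]
  have spec: "Re ` spectrum M = d ` {..<m}"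
    unfolding spectrum_unitary_diag(2)[OF U M(1) d] by (simp add: image_image)
  have dmax: "d j \<le> lambda_max M" if "j < m" for j
    unfolding lambda_max_def spec using that by (intro Max_ge) auto
  define w where "w = mat_adjoint U *\<^sub>v v"
  have w: "w \<in> carrier_vec m" using mult_mat_vec_carrier[OF U'(2) v] by (simp add: w_def)
  have vw: "v = U *\<^sub>v w"
    using U' v by (simp add: w_def flip: assoc_mult_mat_vec[of _ m m _ m])
  have "(M *\<^sub>v v) \<bullet>c v = (mat_adjoint U *\<^sub>v (M *\<^sub>v v)) \<bullet>c w"
    using cscalar_mat_adjoint[OF U'(2) mult_mat_vec_carrier[OF M(1) v] w] by (simp add: vw)
  also have "mat_adjoint U *\<^sub>v (M *\<^sub>v v) = (mat_adjoint U * M * U) *\<^sub>v w"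
    using U' M(1) w by (simp add: vw assoc_mult_mat_vec[of _ m m _ m] mult_carrier_mat[of _ m m _ m])
  finally have "Re ((M *\<^sub>v v) \<bullet>c v) = (\<Sum>j<m. d j * (cmod (w $ j))\<^sup>2)"
    by (simp only: d quadratic_mat_diag[OF w])
  also have "\<dots> \<le> (\<Sum>j<m. lambda_max M * (cmod (w $ j))\<^sup>2)"
    by (intro sum_mono mult_right_mono dmax) auto
  also have "\<dots> = lambda_max M * Re (v \<bullet>c v)"
    unfolding vw cscalar_unitary[OF U w w] Re_cscalar_self[OF w] by (simp add: sum_distrib_left)
  finally show ?thesis .
qed

lemma Rayleigh_bound_herm_part:
  assumes G: "G \<in> carrier_mat m m" and v: "v \<in> carrier_vec m"
  shows "Re ((G *\<^sub>v v) \<bullet>c v) \<le> lambda_max (herm_part G) * Re (v \<bullet>c v)"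
  using Rayleigh_bound[OF herm_part_carrier[OF G] mat_adjoint_herm_part[OF G] v]
  by (simp add: Re_cscalar_herm_part[OF G v])

text \<open>
The square of \<open>sigma1 V\<close> dominates the largest eigenvalue of \<open>V\<^sup>* V\<close>, so this is the Rayleigh bound for
\<open>V\<^sup>* V\<close>.
\<close>

lemma sigma1_bound:
  assumes V: "V \<in> carrier_mat m k" and k: "0 < k" and y: "y \<in> carrier_vec k"
  shows "Re ((V *\<^sub>v y) \<bullet>c (V *\<^sub>v y)) \<le> (sigma1 V)\<^sup>2 * Re (y \<bullet>c y)"
proof -
  define M where "M = mat_adjoint V * V"
  have M: "M \<in> carrier_mat k k" using V by (simp add: M_def mult_carrier_mat[of _ k m _ k])
  have adjM: "mat_adjoint M = M" using V by (simp add: M_def mat_adjoint_mult[of _ k m _ k])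
  have quad: "Re ((M *\<^sub>v u) \<bullet>c u) = Re ((V *\<^sub>v u) \<bullet>c (V *\<^sub>v u))" if u: "u \<in> carrier_vec k" for u
    using cscalar_mat_adjoint[OF mat_adjoint_carrier[OF V] mult_mat_vec_carrier[OF V u] u] V u
    by (simp add: M_def assoc_mult_mat_vec[of _ k m _ k])
  let ?S = "spectrum M"
  have fin: "finite ?S" and ne: "?S \<noteq> {}"
    using card_finite_spectrum(1)[OF M] spectrum_non_empty[OF M] k by auto
  have "lambda_max M \<in> Re ` ?S" unfolding lambda_max_def using fin ne by (intro Max_in) auto
  then obtain e where e: "e \<in> ?S" "lambda_max M = Re e" by blast
  then have sq: "sqrt (lambda_max M) \<le> sigma1 V"
    unfolding sigma1_def using fin by (intro Max_ge) (auto simp: M_def)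
  obtain u :: "complex vec" where u: "u \<in> carrier_vec k" "u \<noteq> 0\<^sub>v k"
    using k by (intro that[of "unit_vec k 0"]) (simp_all add: k)
  have "0 \<le> lambda_max M * Re (u \<bullet>c u)"
    using Rayleigh_bound[OF M adjM u(1)] quad[OF u(1)] Re_cscalar_self_nonneg[of "V *\<^sub>v u"] by linarith
  then have "0 \<le> lambda_max M"
    using Re_cscalar_self_pos[OF u] by (simp add: zero_le_mult_iff)
  then have "lambda_max M \<le> (sigma1 V)\<^sup>2"
    using sq power_mono[OF sq, of 2] by simp
  then show ?thesis
    using Rayleigh_bound[OF M adjM y] quad[OF y] Re_cscalar_self_nonneg[of y]
    by (smt (verit) mult_right_mono)
qed

lemma Re_cscalar_diff:
  assumes x: "x \<in> carrier_vec m" and t: "t \<in> carrier_vec m"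
  shows "Re ((complex_of_real s \<cdot>\<^sub>v x - t) \<bullet>c (complex_of_real s \<cdot>\<^sub>v x - t))
    = s * s * Re (x \<bullet>c x) - 2 * s * Re (x \<bullet>c t) + Re (t \<bullet>c t)"
proof -
  have "Re ((complex_of_real s \<cdot>\<^sub>v x - t) \<bullet>c (complex_of_real s \<cdot>\<^sub>v x - t))
      = (\<Sum>i<m. (cmod (s * x $ i - t $ i))\<^sup>2)"
    using x t by (subst Re_cscalar_self[of _ m]) auto
  also have "\<dots> = (\<Sum>i<m. s * s * (cmod (x $ i))\<^sup>2 - 2 * s * Re (x $ i * cnj (t $ i))
      + (cmod (t $ i))\<^sup>2)"
    unfolding cmod_power2 by (intro sum.cong refl) (simp add: power2_eq_square algebra_simps)
  also have "\<dots> = s * s * (\<Sum>i<m. (cmod (x $ i))\<^sup>2) - 2 * s * (\<Sum>i<m. Re (x $ i * cnj (t $ i)))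
      + (\<Sum>i<m. (cmod (t $ i))\<^sup>2)"
    by (simp only: sum.distrib sum_subtractf sum_distrib_left)
  also have "(\<Sum>i<m. Re (x $ i * cnj (t $ i))) = Re (x \<bullet>c t)"
    using t by (simp add: scalar_prod_def atLeast0LessThan)
  finally show ?thesis by (simp only: Re_cscalar_self[OF x] Re_cscalar_self[OF t])
qed

text \<open>
The adjoint has the same norm.  Expanding \<open>0 \<le> |s x - V V\<^sup>* x|\<^sup>2\<close> with \<open>s = \<sigma>\<^sub>1(V)\<^sup>2\<close> and using the
bound for \<open>V\<close> at the vector \<open>V\<^sup>* x\<close> gives \<open>0 \<le> s (s |x|\<^sup>2 - |V\<^sup>* x|\<^sup>2)\<close>; if \<open>s = 0\<close>, then \<open>V\<close> vanishes.
\<close>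

lemma sigma1_bound_adjoint:
  assumes V: "V \<in> carrier_mat m k" and k: "0 < k" and x: "x \<in> carrier_vec m"
  shows "Re ((mat_adjoint V *\<^sub>v x) \<bullet>c (mat_adjoint V *\<^sub>v x)) \<le> (sigma1 V)\<^sup>2 * Re (x \<bullet>c x)"
proof -
  define s where "s = (sigma1 V)\<^sup>2"
  define y where "y = mat_adjoint V *\<^sub>v x"
  have y: "y \<in> carrier_vec k"
    unfolding y_def using mult_mat_vec_carrier[OF mat_adjoint_carrier[OF V] x] .
  have Vy: "V *\<^sub>v y \<in> carrier_vec m" using mult_mat_vec_carrier[OF V y] .
  have s0: "0 \<le> s" by (simp add: s_def)
  have cross: "Re (x \<bullet>c (V *\<^sub>v y)) = Re (y \<bullet>c y)"
    using cscalar_mat_adjoint[OF mat_adjoint_carrier[OF V] x y] by (simp add: y_def)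
  have bound: "Re ((V *\<^sub>v y) \<bullet>c (V *\<^sub>v y)) \<le> s * Re (y \<bullet>c y)"
    unfolding s_def by (rule sigma1_bound[OF V k y])
  have "0 \<le> Re ((complex_of_real s \<cdot>\<^sub>v x - V *\<^sub>v y) \<bullet>c (complex_of_real s \<cdot>\<^sub>v x - V *\<^sub>v y))"
    by (rule Re_cscalar_self_nonneg)
  also have "\<dots> = s * s * Re (x \<bullet>c x) - 2 * s * Re (x \<bullet>c (V *\<^sub>v y)) + Re ((V *\<^sub>v y) \<bullet>c (V *\<^sub>v y))"
    by (rule Re_cscalar_diff[OF x Vy])
  finally have key: "0 \<le> s * (s * Re (x \<bullet>c x) - Re (y \<bullet>c y))"
    using bound by (simp add: cross algebra_simps)
  show ?thesis
  proof (cases "s = 0")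
    case True
    then have "Re ((V *\<^sub>v y) \<bullet>c (V *\<^sub>v y)) = 0"
      using bound Re_cscalar_self_nonneg[of "V *\<^sub>v y"] by simp
    then have "V *\<^sub>v y = 0\<^sub>v m"
      using Re_cscalar_self_pos[OF Vy] by fastforce
    then have "Re (y \<bullet>c y) = 0" using cross x by simp
    then show ?thesis using True by (simp add: y_def s_def)
  next
    case False
    then have "0 \<le> s * Re (x \<bullet>c x) - Re (y \<bullet>c y)"
      using key s0 by (simp add: zero_le_mult_iff)
    then show ?thesis by (simp add: y_def s_def)
  qed
qed

lemma spectrum_transpose:
  fixes M :: "complex mat"
  assumes "M \<in> carrier_mat n n"
  shows "spectrum (transpose_mat M) = spectrum M"
  using assms spectrum_root_char_poly[of M n] spectrum_root_char_poly[of "transpose_mat M" n] by simp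

lemma smult_mat_mult_vec:
  fixes M :: "'a :: comm_ring mat"
  assumes "M \<in> carrier_mat m n" "v \<in> carrier_vec n"
  shows "(a \<cdot>\<^sub>m M) *\<^sub>v v = a \<cdot>\<^sub>v (M *\<^sub>v v)"
  using assms by (intro eq_vecI) auto

lemma spectrum_smult:
  fixes M :: "complex mat"
  assumes M: "M \<in> carrier_mat n n" and c: "c \<noteq> 0"
  shows "spectrum (c \<cdot>\<^sub>m M) = (*) c ` spectrum M"
proof -
  have "eigenvalue (c \<cdot>\<^sub>m M) (c * e) \<longleftrightarrow> eigenvalue M e" for e
  proof -
    have "c \<cdot>\<^sub>v (M *\<^sub>v v) = (c * e) \<cdot>\<^sub>v v \<longleftrightarrow> M *\<^sub>v v = e \<cdot>\<^sub>v v" for v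
      using c by (auto simp: vec_eq_iff)
    then show ?thesis
      using M by (simp add: eigenvalue_def eigenvector_def smult_mat_mult_vec[OF M] cong: conj_cong)
  qed
  note scale = this
  have "x \<in> (*) c ` spectrum M" if "x \<in> spectrum (c \<cdot>\<^sub>m M)" for x
    using that scale[of "x / c"] c by (intro image_eqI[of _ _ "x / c"]) (auto simp: spectrum_def)
  then show ?thesis using scale by (auto simp: spectrum_def)
qed

lemma spectrum_zero_mat:
  assumes k: "0 < k"
  shows "spectrum (0\<^sub>m k k :: complex mat) = {0}"
proof -
  have "e = 0" if e: "e \<in> spectrum (0\<^sub>m k k :: complex mat)" for e
  proof -
    obtain v :: "complex vec" where v: "v \<in> carrier_vec k" "v \<noteq> 0\<^sub>v k" "0\<^sub>m k k *\<^sub>v v = e \<cdot>\<^sub>v v"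
      using e by (auto simp: spectrum_def eigenvalue_def eigenvector_def)
    then obtain i where "i < k" "v $ i \<noteq> 0" by (auto simp: vec_eq_iff)
    then show ?thesis using v(1) arg_cong[OF v(3), of "\<lambda>u. vec_index u i"] by simp
  qed
  then show ?thesis
    using spectrum_non_empty[OF zero_carrier_mat k] by blast
qed

lemma lambda_max_smult:
  assumes M: "M \<in> carrier_mat n n" and n: "0 < n" and r: "0 < r"
  shows "lambda_max (complex_of_real r \<cdot>\<^sub>m M) = r * lambda_max M"
proof -
  have "finite (Re ` spectrum M)" "Re ` spectrum M \<noteq> {}"
    using card_finite_spectrum(1)[OF M] spectrum_non_empty[OF M n] by auto
  then have "Max ((*) r ` Re ` spectrum M) = r * Max (Re ` spectrum M)"
    using r by (intro mono_Max_commute[symmetric]) (auto simp: mono_def)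
  then show ?thesis
    using spectrum_smult[OF M, of "complex_of_real r"] r by (simp add: lambda_max_def image_image)
qed

lemma sigma1_zero:
  assumes "0 < k"
  shows "sigma1 (0\<^sub>m m k) = 0"
  by (simp add: sigma1_def spectrum_zero_mat[OF assms])

lemma sigma1_scale:
  assumes V: "V \<in> carrier_mat m k" and k: "0 < k" and r: "0 < r"
  shows "sigma1 (complex_of_real r \<cdot>\<^sub>m V) = r * sigma1 V"
proof -
  let ?M = "mat_adjoint V * V"
  have M: "?M \<in> carrier_mat k k" using V by (simp add: mult_carrier_mat[of _ k m _ k])
  have prod: "mat_adjoint (complex_of_real r \<cdot>\<^sub>m V) * (complex_of_real r \<cdot>\<^sub>m V) = complex_of_real (r\<^sup>2) \<cdot>\<^sub>m ?M"
    using V by (intro eq_matI) (auto simp: scalar_prod_def sum_distrib_left power2_eq_square mult_ac)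
  define S where "S = (\<lambda>x. sqrt (Re x)) ` spectrum ?M"
  have S: "finite S" "S \<noteq> {}"
    using card_finite_spectrum(1)[OF M] spectrum_non_empty[OF M k] by (auto simp: S_def)
  have "(\<lambda>x. sqrt (Re x)) ` spectrum (complex_of_real (r\<^sup>2) \<cdot>\<^sub>m ?M) = (*) r ` S"
    using r spectrum_smult[OF M, of "complex_of_real (r\<^sup>2)"]
    by (auto simp: S_def image_image real_sqrt_mult)
  then have "sigma1 (complex_of_real r \<cdot>\<^sub>m V) = Max ((*) r ` S)"
    unfolding sigma1_def prod by simp
  also have "\<dots> = r * Max S"
    using r S by (intro mono_Max_commute[symmetric]) (auto simp: mono_def)
  finally show ?thesis by (simp add: sigma1_def S_def)
qed

text \<open>
The criterion by which the singular values of \<open>V\<close> are compared below: the blocks before and after an operation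
have the same Gram matrix up to transposition.
\<close>

lemma sigma1_transfer:
  assumes V: "V \<in> carrier_mat m k" and V': "V' \<in> carrier_mat m k" and k: "0 < k"
    and "mat_adjoint V' * V' = mat_adjoint V * V \<or> mat_adjoint V' * V' = transpose_mat (mat_adjoint V * V)"
  shows "sigma1 V' = sigma1 V"
  using assms(4) spectrum_transpose[OF mult_carrier_mat[OF mat_adjoint_carrier[OF V] V]]
  by (auto simp: sigma1_def)

section \<open>Determinants, adjugates and the defining inequality\<close>

lemma det_map_cnj: "det (map_mat cnj M) = cnj (det M)"
proof -
  interpret comm_ring_hom cnj by unfold_locales auto
  show ?thesis by simp
qed

lemma det_mat_adjoint:
  assumes "M \<in> carrier_mat n n"
  shows "det (mat_adjoint M) = cnj (det M)"
  using det_transpose[OF mat_adjoint_carrier[OF assms]] by (simp add: transpose_mat_adjoint det_map_cnj)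

text \<open>
The adjugate is compared entry by entry through its cofactors, because the inverse matrix is not
available at the points where the determinant vanishes.
\<close>

lemma adj_mat_transpose:
  assumes "M \<in> carrier_mat n n"
  shows "adj_mat (transpose_mat M) = transpose_mat (adj_mat M)"
proof -
  have del: "mat_delete (transpose_mat M) i j = transpose_mat (mat_delete M j i)" if "i < n" "j < n" for i j
    using assms that by (intro eq_matI) (auto simp: mat_delete_def)
  have "det (mat_delete (transpose_mat M) i j) = det (mat_delete M j i)" if "i < n" "j < n" for i j
    unfolding del[OF that] using assms
    by (intro det_transpose[of _ "n - 1"]) (auto simp: mat_delete_def)
  then show ?thesis using assms
    by (intro eq_matI) (auto simp: adj_mat_def cofactor_def add.commute)
qed

lemma adj_mat_map_cnj:
  assumes "M \<in> carrier_mat n n"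
  shows "adj_mat (map_mat cnj M) = map_mat cnj (adj_mat M)"
proof -
  have "mat_delete (map_mat cnj M) i j = map_mat cnj (mat_delete M i j)" if "i < n" "j < n" for i j
    using assms that by (intro eq_matI) (auto simp: mat_delete_def)
  then show ?thesis
    using assms by (intro eq_matI) (auto simp: adj_mat_def cofactor_def det_map_cnj)
qed

lemma adj_mat_adjoint:
  fixes M :: "complex mat"
  assumes "M \<in> carrier_mat n n"
  shows "adj_mat (mat_adjoint M) = mat_adjoint (adj_mat M)"
proof -
  have adj: "mat_adjoint N = map_mat cnj (transpose_mat N)" for N :: "complex mat"
    by (rule eq_matI) auto
  show ?thesis
    unfolding adj using assms
    by (simp only: adj_mat_map_cnj[of _ n] adj_mat_transpose[OF assms] transpose_carrier_mat)
qed

lemma adj_mat_smult: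
  assumes "M \<in> carrier_mat n n"
  shows "adj_mat (c \<cdot>\<^sub>m M) = c ^ (n - 1) \<cdot>\<^sub>m adj_mat M"
proof -
  have del: "mat_delete (c \<cdot>\<^sub>m M) i j = c \<cdot>\<^sub>m mat_delete M i j" if "i < n" "j < n" for i j
    using assms that by (intro eq_matI) (auto simp: mat_delete_def)
  have "dim_col (mat_delete M i j) = n - 1" for i j
    using assms by (simp add: mat_delete_def)
  with del show ?thesis using assms
    by (intro eq_matI) (auto simp: adj_mat_def cofactor_def)
qed

lemma herm_part_transpose:
  assumes "B \<in> carrier_mat n n"
  shows "herm_part (transpose_mat B) = transpose_mat (herm_part B)"
  using assms by (intro eq_matI) (auto simp: herm_part_def)

lemma herm_part_adjoint:
  assumes "B \<in> carrier_mat n n"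
  shows "herm_part (mat_adjoint B) = herm_part B"
  using assms by (intro eq_matI) (auto simp: herm_part_def add.commute)

lemma herm_part_smult:
  assumes "B \<in> carrier_mat n n"
  shows "herm_part (complex_of_real r \<cdot>\<^sub>m B) = complex_of_real r \<cdot>\<^sub>m herm_part B"
  using assms by (intro eq_matI) (auto simp: herm_part_def algebra_simps)

text \<open>
For invertible \<open>W\<close> this is \<open>|det W|\<^sup>2 (W\<^sup>*)\<^sup>-\<^sup>1\<close>; for singular \<open>W\<close> it is zero.
\<close>

definition scaled_inverse_adjoint :: "complex mat \<Rightarrow> complex mat" where
  "scaled_inverse_adjoint W = det W \<cdot>\<^sub>m adj_mat (mat_adjoint W)"

text \<open>
The inequality of the region with the block \<open>W\<close>, the singular value \<open>s\<close> and the distance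
\<open>x = Re \<lambda> - \<delta>\<^sub>k\<^sub>+\<^sub>1\<close> as independent arguments.
\<close>

definition region_ineq :: "complex mat \<Rightarrow> real \<Rightarrow> real \<Rightarrow> bool" where
  "region_ineq W s x \<longleftrightarrow> (cmod (det W))\<^sup>2 * x \<le> s\<^sup>2 * lambda_max (herm_part (scaled_inverse_adjoint W))"

lemma scaled_inverse_adjoint_carrier:
  "W \<in> carrier_mat k k \<Longrightarrow> scaled_inverse_adjoint W \<in> carrier_mat k k"
  by (simp add: scaled_inverse_adjoint_def adj_mat(1))

text \<open>
A transposed matrix has the same eigenvalues, so the right-hand side does not change.
\<close>

lemma region_ineq_transpose:
  assumes W: "W \<in> carrier_mat k k"
  shows "region_ineq (transpose_mat W) s x = region_ineq W s x"
proof -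
  have "scaled_inverse_adjoint (transpose_mat W) = transpose_mat (scaled_inverse_adjoint W)"
    using W unfolding scaled_inverse_adjoint_def mat_adjoint_transpose
      adj_mat_transpose[OF mat_adjoint_carrier[OF W]] det_transpose[OF W]
    by (intro eq_matI) auto
  then show ?thesis
    using W scaled_inverse_adjoint_carrier[OF W]
    by (simp add: region_ineq_def det_transpose[OF W] herm_part_transpose lambda_max_def
        spectrum_transpose[OF herm_part_carrier])
qed

text \<open>
Replacing \<open>W\<close> by its adjoint replaces the matrix on the right by its adjoint, which has the same
Hermitian part.
\<close>

lemma region_ineq_adjoint:
  assumes W: "W \<in> carrier_mat k k"
  shows "region_ineq (mat_adjoint W) s x = region_ineq W s x"
proof -
  have "scaled_inverse_adjoint (mat_adjoint W) = mat_adjoint (scaled_inverse_adjoint W)"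
    by (simp add: scaled_inverse_adjoint_def adj_mat_adjoint[OF W] det_mat_adjoint[OF W] mat_adjoint_smult)
  then show ?thesis
    by (simp add: region_ineq_def det_mat_adjoint[OF W]
        herm_part_adjoint[OF scaled_inverse_adjoint_carrier[OF W]])
qed

text \<open>
Both sides are homogeneous: the determinant has degree \<open>k\<close> and the adjugate degree \<open>k - 1\<close>, so both sides
are multiplied by \<open>r\<close> to the power \<open>2 k + 1\<close>.
\<close>

lemma region_ineq_scale:
  assumes W: "W \<in> carrier_mat k k" and k: "0 < k" and r: "0 < r"
  shows "region_ineq (complex_of_real r \<cdot>\<^sub>m W) (r * s) (r * x) = region_ineq W s x"
proof -
  let ?G = "scaled_inverse_adjoint W"
  have G: "?G \<in> carrier_mat k k" by (rule scaled_inverse_adjoint_carrier[OF W])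
  have det: "det (complex_of_real r \<cdot>\<^sub>m W) = complex_of_real (r ^ k) * det W"
    using W by simp
  have rk: "r ^ k = r * r ^ (k - 1)"
    using k by (cases k) simp_all
  have "scaled_inverse_adjoint (complex_of_real r \<cdot>\<^sub>m W) = complex_of_real (r ^ k * r ^ (k - 1)) \<cdot>\<^sub>m ?G"
    using W unfolding scaled_inverse_adjoint_def mat_adjoint_smult det complex_cnj_complex_of_real
      adj_mat_smult[OF mat_adjoint_carrier[OF W]]
    by (intro eq_matI) (auto simp: mult_ac)
  then have "lambda_max (herm_part (scaled_inverse_adjoint (complex_of_real r \<cdot>\<^sub>m W)))
      = r ^ k * r ^ (k - 1) * lambda_max (herm_part ?G)"
    using r by (simp only: herm_part_smult[OF G] lambda_max_smult[OF herm_part_carrier[OF G] k]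
        zero_less_power mult_pos_pos)
  moreover have "(cmod (det (complex_of_real r \<cdot>\<^sub>m W)))\<^sup>2 = (r ^ k)\<^sup>2 * (cmod (det W))\<^sup>2"
    unfolding det using r by (simp add: norm_mult norm_power power_mult_distrib)
  ultimately have "region_ineq (complex_of_real r \<cdot>\<^sub>m W) (r * s) (r * x) \<longleftrightarrow>
      ((r ^ k)\<^sup>2 * r) * ((cmod (det W))\<^sup>2 * x) \<le> ((r ^ k)\<^sup>2 * r) * (s\<^sup>2 * lambda_max (herm_part ?G))"
    unfolding region_ineq_def by (simp add: rk power2_eq_square mult_ac)
  then show ?thesis
    using r by (simp add: region_ineq_def)
qed

text \<open>
Both sides vanish.
\<close>

lemma region_ineq_singular:
  assumes W: "W \<in> carrier_mat k k" and k: "0 < k" and det: "det W = 0"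
  shows "region_ineq W s x"
proof -
  have "herm_part (scaled_inverse_adjoint W) = 0\<^sub>m k k"
    using adj_mat(1)[OF mat_adjoint_carrier[OF W]] det
    by (intro eq_matI) (auto simp: herm_part_def scaled_inverse_adjoint_def)
  then show ?thesis
    by (simp add: region_ineq_def det lambda_max_def spectrum_zero_mat[OF k])
qed

text \<open>
Substituting \<open>v = W x\<close> undoes the inverse: \<open>\<langle>(W\<^sup>*)\<^sup>-\<^sup>1 v, v\<rangle> = \<langle>v, W\<^sup>-\<^sup>1 v\<rangle> = \<langle>W x, x\<rangle>\<close>, here with the
factor \<open>|det W|\<^sup>2\<close> cleared.
\<close>

lemma scaled_inverse_adjoint_quadratic:
  assumes W: "W \<in> carrier_mat k k" and x: "x \<in> carrier_vec k"
  shows "Re ((scaled_inverse_adjoint W *\<^sub>v (W *\<^sub>v x)) \<bullet>c (W *\<^sub>v x))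
    = (cmod (det W))\<^sup>2 * Re ((W *\<^sub>v x) \<bullet>c x)"
proof -
  let ?G = "scaled_inverse_adjoint W"
  have G: "?G \<in> carrier_mat k k" by (rule scaled_inverse_adjoint_carrier[OF W])
  have Wx: "W *\<^sub>v x \<in> carrier_vec k" using mult_mat_vec_carrier[OF W x] .
  have "mat_adjoint ?G = cnj (det W) \<cdot>\<^sub>m adj_mat W"
    by (simp add: scaled_inverse_adjoint_def adj_mat_adjoint[OF W] mat_adjoint_smult)
  then have "mat_adjoint ?G * W = (cnj (det W) * det W) \<cdot>\<^sub>m 1\<^sub>m k"
    using mult_smult_assoc_mat[OF adj_mat(1)[OF W] W] adj_mat(3)[OF W] by (intro eq_matI) auto
  also have "cnj (det W) * det W = complex_of_real ((cmod (det W))\<^sup>2)"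
    using complex_norm_square[of "det W"] by (simp only: mult.commute)
  finally have "mat_adjoint ?G *\<^sub>v (W *\<^sub>v x) = complex_of_real ((cmod (det W))\<^sup>2) \<cdot>\<^sub>v x"
    using assoc_mult_mat_vec[OF mat_adjoint_carrier[OF G] W x] x
    by (simp add: smult_mat_mult_vec[OF one_carrier_mat x])
  then show ?thesis
    using cscalar_mat_adjoint[OF G Wx Wx] x Wx by (simp add: conjugate_smult_vec)
qed

text \<open>
The central estimate: the quadratic form of \<open>W\<close> at a vector is controlled by the length of the
image of that vector, without an inverse of \<open>W\<close>.
\<close>

lemma Re_cscalar_mat_vec_le:
  assumes W: "W \<in> carrier_mat k k" and x: "x \<in> carrier_vec k"
  shows "(cmod (det W))\<^sup>2 * Re ((W *\<^sub>v x) \<bullet>c x)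
    \<le> lambda_max (herm_part (scaled_inverse_adjoint W)) * Re ((W *\<^sub>v x) \<bullet>c (W *\<^sub>v x))"
  using Rayleigh_bound_herm_part[OF scaled_inverse_adjoint_carrier[OF W] mult_mat_vec_carrier[OF W x]]
  by (simp add: scaled_inverse_adjoint_quadratic[OF W x])

lemma lambda_max_scaled_inverse_nonneg:
  assumes W: "W \<in> carrier_mat k k" and det: "det W \<noteq> 0"
    and x: "x \<in> carrier_vec k" "x \<noteq> 0\<^sub>v k" and pos: "0 \<le> Re ((W *\<^sub>v x) \<bullet>c x)"
  shows "0 \<le> lambda_max (herm_part (scaled_inverse_adjoint W))"
proof -
  have "W *\<^sub>v x \<noteq> 0\<^sub>v k"
    using det x det_0_iff_vec_prod_zero[OF W] by blast
  then have "0 < Re ((W *\<^sub>v x) \<bullet>c (W *\<^sub>v x))"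
    using Re_cscalar_self_pos[OF mult_mat_vec_carrier[OF W x(1)]] by blast
  moreover have "0 \<le> lambda_max (herm_part (scaled_inverse_adjoint W)) * Re ((W *\<^sub>v x) \<bullet>c (W *\<^sub>v x))"
    using Re_cscalar_mat_vec_le[OF W x(1)] pos by (smt (verit) mult_nonneg_nonneg zero_le_power2)
  ultimately show ?thesis by (simp add: zero_le_mult_iff)
qed

section \<open>The corner block of the rotated matrix\<close>

lemma skew_conj_carrier:
  assumes "B \<in> carrier_mat n n" "U \<in> carrier_mat n n"
  shows "skew_conj B U \<in> carrier_mat n n"
  using assms mat_adjoint_carrier[OF assms(2)]
  by (simp add: skew_conj_def mult_carrier_mat[of _ n n _ n])

text \<open>
The off-diagonal blocks are \<open>V\<close> and \<open>-V\<^sup>*\<close>.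
\<close>

lemma index_skew_conj_swap:
  assumes B: "B \<in> carrier_mat n n" and U: "U \<in> carrier_mat n n" and ij: "i < n" "j < n"
  shows "cnj (skew_conj B U $$ (j, i)) = - skew_conj B U $$ (i, j)"
proof -
  have "skew_conj B U = skew_part (mat_adjoint U * B * U)"
    by (simp add: skew_conj_def skew_part_conj[OF B U])
  then have "mat_adjoint (skew_conj B U) = (- 1) \<cdot>\<^sub>m skew_conj B U"
    using mat_adjoint_skew_part[of "mat_adjoint U * B * U" n] B U
    by (simp add: mult_carrier_mat[of _ n n _ n])
  then have "mat_adjoint (skew_conj B U) $$ (i, j) = ((- 1) \<cdot>\<^sub>m skew_conj B U) $$ (i, j)"
    by simp
  then show ?thesis
    using ij carrier_matD[OF skew_conj_carrier[OF B U]] by simp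
qed

lemma W_mat_carrier: "W_mat k B U z \<in> carrier_mat k k"
  unfolding W_mat_def by (intro minus_carrier_mat) simp

lemma dim_W_mat [simp]: "dim_row (W_mat k B U z) = k" "dim_col (W_mat k B U z) = k"
  using W_mat_carrier by blast+

lemma index_W_mat:
  assumes "i < k" "j < k"
  shows "W_mat k B U z $$ (i, j)
    = (if i = j then complex_of_real (delta B (Suc j)) - z else 0) + skew_conj B U $$ (i, j)"
  using assms by (simp add: W_mat_def Y_block_def mat_diag_def)

lemma V_block_carrier: "B \<in> carrier_mat n n \<Longrightarrow> V_block k B U \<in> carrier_mat (n - k) k"
  by (simp add: V_block_def)

lemma index_V_block:
  assumes "B \<in> carrier_mat n n" "i < n - k" "j < k"
  shows "V_block k B U $$ (i, j) = skew_conj B U $$ (k + i, j)"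
  using assms by (simp add: V_block_def)

lemma mem_E_region_iff:
  "z \<in> E_region k B U \<longleftrightarrow>
    region_ineq (W_mat k B U z) (sigma1 (V_block k B U)) (Re z - delta B (Suc k))"
  by (simp add: E_region_def region_ineq_def scaled_inverse_adjoint_def)

text \<open>
Since \<open>Y\<close> is skew-Hermitian, the Hermitian part of \<open>W\<close> is the diagonal matrix of the
\<open>\<delta>\<^sub>j - Re z\<close>.
\<close>

lemma quadratic_W_mat:
  assumes B: "B \<in> carrier_mat n n" and U: "U \<in> carrier_mat n n" and k: "k \<le> n"
    and x: "x \<in> carrier_vec k"
  shows "Re ((W_mat k B U z *\<^sub>v x) \<bullet>c x) = (\<Sum>j<k. (delta B (Suc j) - Re z) * (cmod (x $ j))\<^sup>2)"
proof -
  have "herm_part (W_mat k B U z) = mat_diag k (\<lambda>j. complex_of_real (delta B (Suc j) - Re z))"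
  proof (rule eq_matI)
    fix i j
    assume "i < dim_row (mat_diag k (\<lambda>j. complex_of_real (delta B (Suc j) - Re z)))"
      "j < dim_col (mat_diag k (\<lambda>j. complex_of_real (delta B (Suc j) - Re z)))"
    then have ij: "i < k" "j < k" by (auto simp: mat_diag_def)
    then show "herm_part (W_mat k B U z) $$ (i, j)
        = mat_diag k (\<lambda>j. complex_of_real (delta B (Suc j) - Re z)) $$ (i, j)"
      using index_skew_conj_swap[OF B U, of i j] k
      by (simp add: index_herm_part[OF W_mat_carrier] index_W_mat mat_diag_def complex_eq_iff)
  qed (auto simp: mat_diag_def herm_part_def)
  then show ?thesis
    using Re_cscalar_herm_part[OF W_mat_carrier x, of B U z] by (simp only: quadratic_mat_diag[OF x])
qed

text \<open>
Testing the quadratic form of \<open>W\<close> on the first unit vector gives \<open>\<delta>\<^sub>1 - Re z\<close>.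
\<close>

lemma lambda_max_W_mat_nonneg:
  assumes B: "B \<in> carrier_mat n n" and U: "U \<in> carrier_mat n n" and k: "0 < k" "k \<le> n"
    and det: "det (W_mat k B U z) \<noteq> 0" and z: "Re z \<le> delta B 1"
  shows "0 \<le> lambda_max (herm_part (scaled_inverse_adjoint (W_mat k B U z)))"
proof -
  let ?e = "unit_vec k 0 :: complex vec"
  have "Re ((W_mat k B U z *\<^sub>v ?e) \<bullet>c ?e) = (\<Sum>j<k. (delta B (Suc j) - Re z) * (cmod (?e $ j))\<^sup>2)"
    by (rule quadratic_W_mat[OF B U k(2)]) simp
  also have "\<dots> = (\<Sum>j<k. if j = 0 then delta B 1 - Re z else 0)"
    using k by (intro sum.cong) (auto simp: unit_vec_def)
  also have "\<dots> = delta B 1 - Re z" using k by simp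
  finally show ?thesis
    using z k by (intro lambda_max_scaled_inverse_nonneg[OF W_mat_carrier det, of ?e]) auto
qed

lemma delta_mono:
  assumes B: "B \<in> carrier_mat n n" and ij: "i \<le> j" "j < n"
  shows "delta B (Suc j) \<le> delta B (Suc i)"
  using eigenframes_nonempty_delta_antimono(2)[OF B] ij by (auto simp: monotone_on_def)

section \<open>Points that belong to every region\<close>

text \<open>
In this half-plane the left-hand side of the inequality is at most zero, and the right-hand side
is nonnegative because \<open>\<delta>\<^sub>k\<^sub>+\<^sub>1 \<le> \<delta>\<^sub>1\<close>.
\<close>

lemma halfplane_subset_E_region:
  assumes B: "B \<in> carrier_mat n n" and U: "U \<in> carrier_mat n n" and k: "0 < k" "k < n"
    and z: "Re z \<le> delta B (Suc k)"
  shows "z \<in> E_region k B U"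
proof (cases "det (W_mat k B U z) = 0")
  case True
  then show ?thesis
    using region_ineq_singular[OF W_mat_carrier k(1)] by (simp add: mem_E_region_iff)
next
  case False
  have "Re z \<le> delta B 1" using delta_mono[OF B, of 0 k] z k by simp
  then have "0 \<le> lambda_max (herm_part (scaled_inverse_adjoint (W_mat k B U z)))"
    using k by (intro lambda_max_W_mat_nonneg[OF B U _ _ False]) auto
  moreover have "(cmod (det (W_mat k B U z)))\<^sup>2 * (Re z - delta B (Suc k)) \<le> 0"
    using z by (simp add: mult_nonneg_nonpos)
  ultimately show ?thesis
    unfolding mem_E_region_iff region_ineq_def by (smt (verit) mult_nonneg_nonneg zero_le_power2)
qed

lemma sum_lessThan_add:
  fixes f :: "nat \<Rightarrow> 'a :: comm_monoid_add"
  shows "(\<Sum>i<k + m. f i) = (\<Sum>i<k. f i) + (\<Sum>i<m. f (k + i))"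
  by (induction m) (simp_all add: add.assoc)

text \<open>
The eigenvector, written in the frame and split after its \<open>k\<close>-th coordinate, gives a vector
\<open>y\<^sub>1\<close> at which the quadratic form of \<open>W\<close> is large and whose image \<open>W y\<^sub>1 = V\<^sup>* y\<^sub>2\<close> is small.
\<close>

lemma spectrum_subset_E_region:
  assumes B: "B \<in> carrier_mat n n" and fr: "U \<in> eigenframes B" and k: "0 < k" "k < n"
    and z: "z \<in> spectrum B"
  shows "z \<in> E_region k B U"
proof (cases "det (W_mat k B U z) = 0")
  case True
  then show ?thesis
    using region_ineq_singular[OF W_mat_carrier k(1)] by (simp add: mem_E_region_iff)
next
  case False
  note uU = eigenframesD[OF B fr]
  note U = unitary_matD[OF uU(1)]
  define m where "m = n - k"
  have n: "n = k + m" using k by (simp add: m_def)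
  define t where "t = Re z"
  define d where "d = (\<lambda>j. delta B (Suc j))"
  define W where "W = W_mat k B U z"
  have W: "W \<in> carrier_mat k k" by (simp add: W_def W_mat_carrier)
  define V where "V = V_block k B U"
  have V: "V \<in> carrier_mat m k" using V_block_carrier[OF B] by (simp add: V_def m_def)
  define M where "M = mat_adjoint U * B * U"
  have M: "M \<in> carrier_mat n n" using B U by (simp add: M_def mult_carrier_mat[of _ n n _ n])
  have hM: "herm_part M = mat_diag n (\<lambda>j. complex_of_real (d j))"
    unfolding M_def herm_part_conj[OF B U(1)] uU(2) d_def ..
  have sM: "skew_part M = skew_conj B U"
    unfolding M_def skew_part_conj[OF B U(1)] skew_conj_def ..
  have M_index: "M $$ (i, j) = (if i = j then complex_of_real (d j) else 0) + skew_conj B U $$ (i, j)"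
    if "i < n" "j < n" for i j
  proof -
    have "M $$ (i, j) = (herm_part M + skew_part M) $$ (i, j)"
      using herm_plus_skew[OF M] by simp
    then show ?thesis
      using that skew_conj_carrier[OF B U(1)] by (simp add: hM sM mat_diag_def)
  qed
  obtain x where x: "x \<in> carrier_vec n" "x \<noteq> 0\<^sub>v n" "B *\<^sub>v x = z \<cdot>\<^sub>v x"
    using z B by (auto simp: spectrum_def eigenvalue_def eigenvector_def)
  define y where "y = mat_adjoint U *\<^sub>v x"
  have y: "y \<in> carrier_vec n" using mult_mat_vec_carrier[OF U(2) x(1)] by (simp add: y_def)
  have xy: "x = U *\<^sub>v y"
    using U x(1) by (simp add: y_def flip: assoc_mult_mat_vec[of _ n n _ n])
  have y0: "y \<noteq> 0\<^sub>v n"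
    using x(2) U(1) by (auto simp: xy)
  have My: "M *\<^sub>v y = z \<cdot>\<^sub>v y"
  proof -
    have "M *\<^sub>v y = mat_adjoint U *\<^sub>v (B *\<^sub>v x)"
      using U B y x(1) by (simp add: M_def xy assoc_mult_mat_vec[of _ n n _ n] mult_carrier_mat[of _ n n _ n])
    then show ?thesis
      using mult_mat_vec[OF U(2) x(1)] by (simp add: x(3) y_def)
  qed
  have "Re ((M *\<^sub>v y) \<bullet>c y) = (\<Sum>j<n. d j * (cmod (y $ j))\<^sup>2)"
    using Re_cscalar_herm_part[OF M y] by (simp only: hM quadratic_mat_diag[OF y])
  moreover have "Re ((M *\<^sub>v y) \<bullet>c y) = t * (\<Sum>j<n. (cmod (y $ j))\<^sup>2)"
  proof -
    have "Im (y \<bullet>c y) = 0"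
      using conjugate_square_ge_0_vec[of y] by (simp add: less_eq_complex_def)
    then show ?thesis
      using y Re_cscalar_self[OF y] by (simp add: My t_def)
  qed
  \<comment> \<open>The real part of the eigenvalue equation paired with \<open>y\<close>.\<close>
  ultimately have energy: "(\<Sum>j<n. (d j - t) * (cmod (y $ j))\<^sup>2) = 0"
    by (simp add: left_diff_distrib sum_subtractf sum_distrib_left)
  define y1 where "y1 = vec k (\<lambda>i. y $ i)"
  define y2 where "y2 = vec m (\<lambda>i. y $ (k + i))"
  have y1: "y1 \<in> carrier_vec k" and y2: "y2 \<in> carrier_vec m" by (simp_all add: y1_def y2_def)
  \<comment> \<open>The first \<open>k\<close> rows of the eigenvalue equation.\<close>
  have eq: "W *\<^sub>v y1 = mat_adjoint V *\<^sub>v y2"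
  proof (rule eq_vecI)
    fix i assume "i < dim_vec (mat_adjoint V *\<^sub>v y2)"
    then have i: "i < k" using V by simp
    have "z * y $ i = (\<Sum>j<n. M $$ (i, j) * y $ j)"
      using arg_cong[OF My, of "\<lambda>u. vec_index u i"] i M y n by (simp add: scalar_prod_def atLeast0LessThan)
    also have "\<dots> = (\<Sum>j<k. M $$ (i, j) * y $ j) + (\<Sum>j<m. M $$ (i, k + j) * y $ (k + j))"
      unfolding n by (rule sum_lessThan_add)
    also have "(\<Sum>j<k. M $$ (i, j) * y $ j) = (W *\<^sub>v y1) $ i + z * y $ i"
    proof -
      have "(\<Sum>j<k. M $$ (i, j) * y $ j)
          = (\<Sum>j<k. W $$ (i, j) * y $ j + (if j = i then z * y $ i else 0))"
        using i n by (intro sum.cong) (auto simp: M_index W_def index_W_mat d_def algebra_simps)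
      also have "\<dots> = (\<Sum>j<k. W $$ (i, j) * y $ j) + z * y $ i"
        using i by (simp add: sum.distrib)
      also have "(\<Sum>j<k. W $$ (i, j) * y $ j) = (W *\<^sub>v y1) $ i"
        using i W by (simp add: scalar_prod_def atLeast0LessThan y1_def)
      finally show ?thesis .
    qed
    also have "(\<Sum>j<m. M $$ (i, k + j) * y $ (k + j)) = - (mat_adjoint V *\<^sub>v y2) $ i"
    proof -
      have "M $$ (i, k + j) = - cnj (V $$ (j, i))" if "j < m" for j
        using that i n index_skew_conj_swap[OF B U(1), of i "k + j"]
        by (simp add: M_index V_def index_V_block[OF B])
      then have "(\<Sum>j<m. M $$ (i, k + j) * y $ (k + j)) = (\<Sum>j<m. - (cnj (V $$ (j, i)) * y $ (k + j)))"
        by (intro sum.cong) auto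
      also have "\<dots> = - (mat_adjoint V *\<^sub>v y2) $ i"
        using i V by (simp add: scalar_prod_def atLeast0LessThan y2_def sum_negf)
      finally show ?thesis .
    qed
    finally show "(W *\<^sub>v y1) $ i = (mat_adjoint V *\<^sub>v y2) $ i" by simp
  qed (use W V in auto)
  have pos: "0 < Re (y \<bullet>c y)" by (rule Re_cscalar_self_pos[OF y y0])
  \<comment> \<open>Otherwise all terms of the sum in \<open>energy\<close> would be at most zero and some strictly negative.\<close>
  have t_le: "t \<le> delta B 1"
  proof (rule ccontr)
    assume "\<not> t \<le> delta B 1"
    then have neg: "d 0 - t < 0" by (simp add: d_def)
    have "(\<Sum>j<n. (d j - t) * (cmod (y $ j))\<^sup>2) \<le> (\<Sum>j<n. (d 0 - t) * (cmod (y $ j))\<^sup>2)"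
      using delta_mono[OF B, of 0] by (intro sum_mono mult_right_mono) (auto simp: d_def)
    also have "\<dots> = (d 0 - t) * Re (y \<bullet>c y)"
      by (simp add: Re_cscalar_self[OF y] sum_distrib_left)
    also have "\<dots> < 0" using neg pos by (rule mult_neg_pos)
    finally show False using energy by simp
  qed
  \<comment> \<open>Here invertibility of \<open>W\<close> enters: \<open>y2 = 0\<close> would force \<open>y1 = 0\<close>.\<close>
  have y20: "y2 \<noteq> 0\<^sub>v m"
  proof
    assume y2_zero: "y2 = 0\<^sub>v m"
    then have "W *\<^sub>v y1 = 0\<^sub>v k"
      unfolding eq using V by (intro eq_vecI) (auto simp: scalar_prod_def)
    then have "y1 = 0\<^sub>v k"
      using False det_0_iff_vec_prod_zero[OF W] y1 by (auto simp: W_def)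
    then have "y $ j = 0" if "j < n" for j
    proof (cases "j < k")
      case True
      then show ?thesis using arg_cong[OF \<open>y1 = 0\<^sub>v k\<close>, of "\<lambda>u. vec_index u j"] by (simp add: y1_def)
    next
      case False
      then show ?thesis using arg_cong[OF y2_zero, of "\<lambda>u. vec_index u (j - k)"] that n
        by (simp add: y2_def)
    qed
    then have "y = 0\<^sub>v n" using y by (intro eq_vecI) auto
    then show False using y0 by contradiction
  qed
  define L where "L = lambda_max (herm_part (scaled_inverse_adjoint W))"
  have L0: "0 \<le> L"
    unfolding L_def W_def using k t_le
    by (intro lambda_max_W_mat_nonneg[OF B U(1) _ _ False]) (auto simp: t_def)
  have "(\<Sum>j<n. (d j - t) * (cmod (y $ j))\<^sup>2)
      = Re ((W *\<^sub>v y1) \<bullet>c y1) + (\<Sum>j<m. (d (k + j) - t) * (cmod (y2 $ j))\<^sup>2)"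
    using quadratic_W_mat[OF B U(1) _ y1, of z] k
    unfolding n sum_lessThan_add by (simp add: W_def d_def t_def y1_def y2_def)
  moreover have "(\<Sum>j<m. (d (k + j) - t) * (cmod (y2 $ j))\<^sup>2) \<le> (\<Sum>j<m. (d k - t) * (cmod (y2 $ j))\<^sup>2)"
    using delta_mono[OF B, of k] n by (intro sum_mono mult_right_mono) (auto simp: d_def)
  moreover have "(\<Sum>j<m. (d k - t) * (cmod (y2 $ j))\<^sup>2) = (d k - t) * Re (y2 \<bullet>c y2)"
    by (simp add: Re_cscalar_self[OF y2] sum_distrib_left)
  ultimately have "(t - d k) * Re (y2 \<bullet>c y2) \<le> Re ((W *\<^sub>v y1) \<bullet>c y1)"
    using energy by (simp add: algebra_simps)
  then have "(cmod (det W))\<^sup>2 * ((t - d k) * Re (y2 \<bullet>c y2)) \<le> (cmod (det W))\<^sup>2 * Re ((W *\<^sub>v y1) \<bullet>c y1)"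
    by (intro mult_left_mono) auto
  also have "\<dots> \<le> L * Re ((mat_adjoint V *\<^sub>v y2) \<bullet>c (mat_adjoint V *\<^sub>v y2))"
    using Re_cscalar_mat_vec_le[OF W y1] unfolding L_def eq .
  also have "\<dots> \<le> L * ((sigma1 V)\<^sup>2 * Re (y2 \<bullet>c y2))"
    using sigma1_bound_adjoint[OF V k(1) y2] L0 by (rule mult_left_mono)
  finally have "((cmod (det W))\<^sup>2 * (t - d k)) * Re (y2 \<bullet>c y2) \<le> ((sigma1 V)\<^sup>2 * L) * Re (y2 \<bullet>c y2)"
    by (simp add: mult_ac)
  then have "(cmod (det W))\<^sup>2 * (t - d k) \<le> (sigma1 V)\<^sup>2 * L"
    using Re_cscalar_self_pos[OF y2 y20] by simp
  then show ?thesis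
    by (simp add: mem_E_region_iff region_ineq_def W_def V_def L_def t_def d_def)
qed

text \<open>
The argument of Courant and Fischer: the range of \<open>X\<close> has dimension \<open>k + 1\<close>, so it contains a
nonzero vector orthogonal to the first \<open>k\<close> eigenvectors, and on such vectors the quadratic form of
the Hermitian part is at most \<open>\<delta>\<^sub>k\<^sub>+\<^sub>1\<close> times the squared length.
\<close>

lemma compression_le_delta:
  assumes B: "B \<in> carrier_mat n n" and fr: "U \<in> eigenframes B" and k: "k < n"
    and X: "X \<in> carrier_mat n (Suc k)" "mat_adjoint X * X = 1\<^sub>m (Suc k)"
    and z: "mat_adjoint X * B * X = z \<cdot>\<^sub>m 1\<^sub>m (Suc k)"
  shows "Re z \<le> delta B (Suc k)"
proof -
  note uU = eigenframesD[OF B fr]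
  note U = unitary_matD[OF uU(1)]
  define d where "d = (\<lambda>j. delta B (Suc j))"
  define Q where "Q = mat_adjoint U * X"
  have Q: "Q \<in> carrier_mat n (Suc k)" using U X by (simp add: Q_def mult_carrier_mat[of _ n n])
  \<comment> \<open>The first \<open>k\<close> coordinates of \<open>U\<^sup>* X c\<close> are to vanish; the zero row makes the system square and singular.\<close>
  define R where "R = mat (Suc k) (Suc k) (\<lambda>(i, j). if i < k then Q $$ (i, j) else 0)"
  have R: "R \<in> carrier_mat (Suc k) (Suc k)" by (simp add: R_def)
  have "det R = 0"
    unfolding laplace_expansion_row[OF R lessI] by (simp add: R_def)
  then obtain c where c: "c \<in> carrier_vec (Suc k)" "c \<noteq> 0\<^sub>v (Suc k)" "R *\<^sub>v c = 0\<^sub>v (Suc k)"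
    using det_0_iff_vec_prod_zero[OF R] by auto
  define x where "x = X *\<^sub>v c"
  have x: "x \<in> carrier_vec n" using mult_mat_vec_carrier[OF X(1) c(1)] by (simp add: x_def)
  define y where "y = mat_adjoint U *\<^sub>v x"
  have y: "y \<in> carrier_vec n" using mult_mat_vec_carrier[OF U(2) x] by (simp add: y_def)
  have yQ: "y = Q *\<^sub>v c"
    using assoc_mult_mat_vec[OF U(2) X(1) c(1)] by (simp add: y_def x_def Q_def)
  have xy: "x = U *\<^sub>v y"
    using U x by (simp add: y_def flip: assoc_mult_mat_vec[of _ n n _ n])
  have y_zero: "y $ j = 0" if "j < k" for j
    using arg_cong[OF c(3), of "\<lambda>u. vec_index u j"] that Q c(1) k
    by (simp add: yQ R_def scalar_prod_def)
  have norm: "x \<bullet>c x = c \<bullet>c c"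
    using cscalar_mat_adjoint[OF X(1) c(1) x] X c(1)
    by (simp add: x_def flip: assoc_mult_mat_vec[of _ "Suc k" n _ "Suc k"])
  have "(B *\<^sub>v x) \<bullet>c x = z * (c \<bullet>c c)"
  proof -
    have "(B *\<^sub>v x) \<bullet>c x = (mat_adjoint X *\<^sub>v (B *\<^sub>v x)) \<bullet>c c"
      using cscalar_mat_adjoint[OF mat_adjoint_carrier[OF X(1)] mult_mat_vec_carrier[OF B x] c(1)]
      by (simp add: x_def)
    also have "mat_adjoint X *\<^sub>v (B *\<^sub>v x) = (mat_adjoint X * B * X) *\<^sub>v c"
      using X(1) B c(1) mult_carrier_mat[OF mat_adjoint_carrier[OF X(1)] B]
        assoc_mult_mat_vec[OF mat_adjoint_carrier[OF X(1)] B x]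
        assoc_mult_mat_vec[OF mult_carrier_mat[OF mat_adjoint_carrier[OF X(1)] B] X(1) c(1)]
      by (simp add: x_def)
    finally show ?thesis
      using c(1) by (simp add: z smult_mat_mult_vec[OF one_carrier_mat c(1)])
  qed
  then have "Re ((B *\<^sub>v x) \<bullet>c x) = Re z * Re (y \<bullet>c y)"
    using norm conjugate_square_ge_0_vec[of c] cscalar_unitary[OF uU(1) y y]
    by (simp add: less_eq_complex_def xy)
  moreover have "Re ((B *\<^sub>v x) \<bullet>c x) = (\<Sum>j<n. d j * (cmod (y $ j))\<^sup>2)"
  proof -
    have "Re ((B *\<^sub>v x) \<bullet>c x) = Re ((herm_part B *\<^sub>v x) \<bullet>c x)"
      by (simp add: Re_cscalar_herm_part[OF B x])
    also have "(herm_part B *\<^sub>v x) \<bullet>c x = (mat_adjoint U *\<^sub>v (herm_part B *\<^sub>v x)) \<bullet>c y"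
      using cscalar_mat_adjoint[OF U(2) mult_mat_vec_carrier[OF herm_part_carrier[OF B] x] y]
      by (simp add: xy)
    also have "mat_adjoint U *\<^sub>v (herm_part B *\<^sub>v x) = (mat_adjoint U * herm_part B * U) *\<^sub>v y"
      using U herm_part_carrier[OF B] y
      by (simp add: xy assoc_mult_mat_vec[of _ n n _ n] mult_carrier_mat[of _ n n _ n])
    finally show ?thesis by (simp only: uU(2) d_def quadratic_mat_diag[OF y])
  qed
  moreover have "(\<Sum>j<n. d j * (cmod (y $ j))\<^sup>2) \<le> (\<Sum>j<n. d k * (cmod (y $ j))\<^sup>2)"
  proof (intro sum_mono)
    fix j assume "j \<in> {..<n}"
    then show "d j * (cmod (y $ j))\<^sup>2 \<le> d k * (cmod (y $ j))\<^sup>2"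
      using delta_mono[OF B, of k j] y_zero[of j]
      by (cases "j < k") (auto simp: d_def intro: mult_right_mono)
  qed
  moreover have "(\<Sum>j<n. d k * (cmod (y $ j))\<^sup>2) = d k * Re (y \<bullet>c y)"
    by (simp add: Re_cscalar_self[OF y] sum_distrib_left)
  moreover have "0 < Re (y \<bullet>c y)"
    using norm Re_cscalar_self_pos[OF c(1,2)] cscalar_unitary[OF uU(1) y y] by (simp add: xy)
  ultimately show ?thesis by (simp add: d_def)
qed

section \<open>Behaviour of a single region under the matrix operations\<close>

text \<open>
In the frame \<open>P\<^sup>* U\<close> the new matrix has literally the same entries as the old one in the frame \<open>U\<close>.
\<close>

lemma E_region_unitary:
  assumes B: "B \<in> carrier_mat n n" and P: "unitary_mat n P" and fr: "U \<in> eigenframes B" and k: "k < n"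
  shows "mat_adjoint P * U \<in> eigenframes (mat_adjoint P * B * P)"
    "E_region k (mat_adjoint P * B * P) (mat_adjoint P * U) = E_region k B U"
proof -
  note P' = unitary_matD[OF P]
  note uU = eigenframesD[OF B fr]
  note U = unitary_matD[OF uU(1)]
  let ?B = "mat_adjoint P * B * P" and ?U = "mat_adjoint P * U"
  have B': "?B \<in> carrier_mat n n" using B P' by (simp add: mult_carrier_mat[of _ n n _ n])
  have conj: "mat_adjoint ?U * (mat_adjoint P * X * P) * ?U = mat_adjoint U * X * U"
    if X: "X \<in> carrier_mat n n" for X
  proof -
    have "mat_adjoint ?U * (mat_adjoint P * X * P) * ?U
        = mat_adjoint U * (P * mat_adjoint P) * X * (P * mat_adjoint P) * U"
      using X P'(1,2) U(1,2)
      by (simp add: mat_adjoint_mult[of _ n n _ n] assoc_mult_mat[of _ n n _ n _ n] mult_carrier_mat[of _ n n _ n])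
    also have "\<dots> = mat_adjoint U * X * U"
      using X P' U by (simp add: mult_carrier_mat[of _ n n _ n])
    finally show ?thesis .
  qed
  have diag: "mat_adjoint ?U * herm_part ?B * ?U = mat_diag n (\<lambda>j. complex_of_real (delta B (Suc j)))"
    unfolding herm_part_conj[OF B P'(1)] conj[OF herm_part_carrier[OF B]] uU(2) ..
  have unitary: "unitary_mat n ?U"
    by (intro unitary_mat_mult unitary_mat_adjoint P uU(1))
  note frame = eigenframesI[OF B' unitary diag eigenframes_nonempty_delta_antimono(2)[OF B]]
  show "?U \<in> eigenframes ?B" by (rule frame(1))
  have sk: "skew_conj ?B ?U = skew_conj B U"
    unfolding skew_conj_def skew_part_conj[OF B P'(1)] conj[OF skew_part_carrier[OF B]] ..
  have "W_mat k ?B ?U z = W_mat k B U z" for z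
    using k by (intro eq_matI) (auto simp: index_W_mat sk frame(2))
  moreover have "V_block k ?B ?U = V_block k B U"
    using B P'(1) by (simp add: V_block_def sk)
  ultimately show "E_region k ?B ?U = E_region k B U"
    using frame(2)[OF k] by (auto simp: mem_E_region_iff)
qed

text \<open>
The transpose of a Hermitian matrix is its complex conjugate, so its eigenvectors are the conjugated ones.  In
that frame the matrix is the transpose of the old one: \<open>W\<close> is transposed and the new off-diagonal
block is \<open>-V\<close> with conjugated entries.
\<close>

lemma E_region_transpose:
  assumes B: "B \<in> carrier_mat n n" and fr: "U \<in> eigenframes B" and k: "0 < k" "k < n"
  shows "map_mat cnj U \<in> eigenframes (transpose_mat B)"
    "E_region k (transpose_mat B) (map_mat cnj U) = E_region k B U"
proof -
  note uU = eigenframesD[OF B fr]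
  note U = unitary_matD[OF uU(1)]
  let ?B = "transpose_mat B" and ?U = "map_mat cnj U"
  have B': "?B \<in> carrier_mat n n" and U': "?U \<in> carrier_mat n n" using B U by simp_all
  have adjU: "mat_adjoint ?U = transpose_mat U"
    by (rule eq_matI) auto
  have conj: "mat_adjoint ?U * transpose_mat X * ?U = transpose_mat (mat_adjoint U * X * U)"
    if X: "X \<in> carrier_mat n n" for X
    unfolding adjU using X U(1,2)
    by (simp add: transpose_mult[of _ n n _ n] mult_carrier_mat[of _ n n _ n] transpose_mat_adjoint
        assoc_mult_mat[of _ n n _ n _ n])
  have diag: "mat_adjoint ?U * herm_part ?B * ?U = mat_diag n (\<lambda>j. complex_of_real (delta B (Suc j)))"
    unfolding herm_part_transpose[OF B] conj[OF herm_part_carrier[OF B]] uU(2)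
    by (rule eq_matI) (auto simp: mat_diag_def)
  have unitary: "unitary_mat n ?U"
    using conj[of "1\<^sub>m n"] U U' adjU by (simp add: unitary_mat_def)
  note frame = eigenframesI[OF B' unitary diag eigenframes_nonempty_delta_antimono(2)[OF B]]
  show "?U \<in> eigenframes ?B" by (rule frame(1))
  have "skew_part ?B = transpose_mat (skew_part B)"
    using B by (intro eq_matI) (auto simp: skew_part_def)
  then have sk: "skew_conj ?B ?U = transpose_mat (skew_conj B U)"
    unfolding skew_conj_def by (simp only: conj[OF skew_part_carrier[OF B]])
  note skc = carrier_matD[OF skew_conj_carrier[OF B U(1)]]
  have W: "W_mat k ?B ?U z = transpose_mat (W_mat k B U z)" for z
    using k skc by (intro eq_matI) (auto simp: index_W_mat sk frame(2))
  have V: "V_block k ?B ?U $$ (i, j) = - cnj (V_block k B U $$ (i, j))" if "i < n - k" "j < k" for i j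
    using that skc index_skew_conj_swap[OF B U(1), of j "k + i"]
    by (simp add: index_V_block[OF B] index_V_block[OF B'] sk)
  have "mat_adjoint (V_block k ?B ?U) * V_block k ?B ?U
      = transpose_mat (mat_adjoint (V_block k B U) * V_block k B U)"
    using carrier_matD[OF V_block_carrier[OF B, of k U]] carrier_matD[OF V_block_carrier[OF B', of k ?U]]
    by (intro eq_matI) (auto simp: scalar_prod_def V mult.commute)
  then have "sigma1 (V_block k ?B ?U) = sigma1 (V_block k B U)"
    by (intro sigma1_transfer[OF V_block_carrier[OF B] V_block_carrier[OF B'] k(1)]) simp
  then show "E_region k ?B ?U = E_region k B U"
    using frame(2)[OF k(2)] by (auto simp: mem_E_region_iff W region_ineq_transpose[OF W_mat_carrier])
qed

text \<open>
The Hermitian part is unchanged and the skew-Hermitian part changes sign, so \<open>W\<close> at the conjugated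
point is the adjoint of \<open>W\<close>, and \<open>V\<close> changes sign.
\<close>

lemma E_region_adjoint:
  assumes B: "B \<in> carrier_mat n n" and fr: "U \<in> eigenframes B" and k: "0 < k" "k < n"
  shows "U \<in> eigenframes (mat_adjoint B)"
    "z \<in> E_region k B U \<Longrightarrow> cnj z \<in> E_region k (mat_adjoint B) U"
proof -
  note uU = eigenframesD[OF B fr]
  note U = unitary_matD[OF uU(1)]
  let ?B = "mat_adjoint B"
  have B': "?B \<in> carrier_mat n n" using B by simp
  have diag: "mat_adjoint U * herm_part ?B * U = mat_diag n (\<lambda>j. complex_of_real (delta B (Suc j)))"
    unfolding herm_part_adjoint[OF B] uU(2) ..
  note frame = eigenframesI[OF B' uU(1) diag eigenframes_nonempty_delta_antimono(2)[OF B]]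
  show "U \<in> eigenframes ?B" by (rule frame(1))
  have "skew_part ?B = (- 1) \<cdot>\<^sub>m skew_part B"
    using B by (intro eq_matI) (auto simp: skew_part_def minus_divide_left)
  then have sk: "skew_conj ?B U = (- 1) \<cdot>\<^sub>m skew_conj B U"
    using U skew_part_carrier[OF B]
    by (simp add: skew_conj_def mult_smult_distrib[of _ n n _ n] mult_smult_assoc_mat[of _ n n _ n]
        mult_carrier_mat[of _ n n _ n])
  note skc = carrier_matD[OF skew_conj_carrier[OF B U(1)]]
  have W: "W_mat k ?B U (cnj z) = mat_adjoint (W_mat k B U z)" for z
    using k skc index_skew_conj_swap[OF B U(1)]
    by (intro eq_matI) (auto simp: index_W_mat sk frame(2))
  have V: "V_block k ?B U $$ (i, j) = - V_block k B U $$ (i, j)" if "i < n - k" "j < k" for i j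
    using that skc by (simp add: index_V_block[OF B] index_V_block[OF B'] sk)
  have "mat_adjoint (V_block k ?B U) * V_block k ?B U = mat_adjoint (V_block k B U) * V_block k B U"
    using carrier_matD[OF V_block_carrier[OF B, of k U]] carrier_matD[OF V_block_carrier[OF B', of k U]]
    by (intro eq_matI) (auto simp: scalar_prod_def V)
  then have "sigma1 (V_block k ?B U) = sigma1 (V_block k B U)"
    by (intro sigma1_transfer[OF V_block_carrier[OF B] V_block_carrier[OF B'] k(1)]) simp
  then show "z \<in> E_region k B U \<Longrightarrow> cnj z \<in> E_region k ?B U"
    using frame(2)[OF k(2)] by (simp add: mem_E_region_iff W region_ineq_adjoint[OF W_mat_carrier])
qed

text \<open>
A positive factor preserves the order of the eigenvalues and a multiple of the identity shifts all
of them equally, so the frame stays the same.  A factor that is not positive is covered only through the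
rotations.
\<close>

lemma E_region_affine:
  assumes B: "B \<in> carrier_mat n n" and fr: "U \<in> eigenframes B" and k: "0 < k" "k < n" and r: "0 < r"
  shows "U \<in> eigenframes (complex_of_real r \<cdot>\<^sub>m B + b \<cdot>\<^sub>m 1\<^sub>m n)"
    "complex_of_real r * z + b \<in> E_region k (complex_of_real r \<cdot>\<^sub>m B + b \<cdot>\<^sub>m 1\<^sub>m n) U \<longleftrightarrow> z \<in> E_region k B U"
proof -
  note uU = eigenframesD[OF B fr]
  note U = unitary_matD[OF uU(1)]
  let ?B = "complex_of_real r \<cdot>\<^sub>m B + b \<cdot>\<^sub>m 1\<^sub>m n"
  have B': "?B \<in> carrier_mat n n" using B by simp
  have conj: "mat_adjoint U * (complex_of_real r \<cdot>\<^sub>m X + c \<cdot>\<^sub>m 1\<^sub>m n) * U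
      = complex_of_real r \<cdot>\<^sub>m (mat_adjoint U * X * U) + c \<cdot>\<^sub>m 1\<^sub>m n"
    if X: "X \<in> carrier_mat n n" for X c
    using X U by (simp add: mult_smult_distrib[of _ n n _ n] mult_smult_assoc_mat[of _ n n _ n]
        mult_carrier_mat[of _ n n _ n] mult_add_distrib_mat[of _ n n _ n] add_mult_distrib_mat[of _ n n _ _ n])
  have herm: "herm_part ?B = complex_of_real r \<cdot>\<^sub>m herm_part B + complex_of_real (Re b) \<cdot>\<^sub>m 1\<^sub>m n"
    using B by (intro eq_matI) (auto simp: herm_part_def complex_eq_iff algebra_simps)
  have skew: "skew_part ?B = complex_of_real r \<cdot>\<^sub>m skew_part B + (\<i> * complex_of_real (Im b)) \<cdot>\<^sub>m 1\<^sub>m n"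
    using B by (intro eq_matI) (auto simp: skew_part_def complex_eq_iff algebra_simps)
  have diag: "mat_adjoint U * herm_part ?B * U = mat_diag n (\<lambda>j. complex_of_real (r * delta B (Suc j) + Re b))"
    unfolding herm conj[OF herm_part_carrier[OF B]] uU(2)
    by (rule eq_matI) (auto simp: mat_diag_def)
  have mono: "antimono_on {..<n} (\<lambda>j. r * delta B (Suc j) + Re b)"
    using eigenframes_nonempty_delta_antimono(2)[OF B] r by (auto simp: monotone_on_def)
  note frame = eigenframesI[OF B' uU(1) diag mono]
  show "U \<in> eigenframes ?B" by (rule frame(1))
  have sk: "skew_conj ?B U = complex_of_real r \<cdot>\<^sub>m skew_conj B U + (\<i> * complex_of_real (Im b)) \<cdot>\<^sub>m 1\<^sub>m n"
    unfolding skew_conj_def skew conj[OF skew_part_carrier[OF B]] ..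
  note skc = carrier_matD[OF skew_conj_carrier[OF B U(1)]]
  have W: "W_mat k ?B U (complex_of_real r * z + b) = complex_of_real r \<cdot>\<^sub>m W_mat k B U z"
    using k skc by (intro eq_matI) (auto simp: index_W_mat sk frame(2) complex_eq_iff algebra_simps)
  have V: "V_block k ?B U = complex_of_real r \<cdot>\<^sub>m V_block k B U"
    using k skc B B' by (intro eq_matI) (auto simp: V_block_def sk)
  have x: "Re (complex_of_real r * z + b) - delta ?B (Suc k) = r * (Re z - delta B (Suc k))"
    using frame(2)[OF k(2)] by (simp add: algebra_simps)
  show "complex_of_real r * z + b \<in> E_region k ?B U \<longleftrightarrow> z \<in> E_region k B U"
    unfolding mem_E_region_iff W V x sigma1_scale[OF V_block_carrier[OF B] k(1) r]
    by (rule region_ineq_scale[OF W_mat_carrier k(1) r])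
qed

text \<open>
For a scalar matrix \<open>V = 0\<close> and \<open>det W = (b - z)\<^sup>k\<close>, so the inequality says that
\<open>|b - z|\<^sup>2\<^sup>k (Re z - Re b)\<close> is at most zero.
\<close>

lemma E_region_scalar_subset_halfplane:
  assumes fr: "U \<in> eigenframes (b \<cdot>\<^sub>m 1\<^sub>m n)" and k: "0 < k" "k < n"
    and z: "z \<in> E_region k (b \<cdot>\<^sub>m 1\<^sub>m n) U"
  shows "Re z \<le> Re b"
proof (rule ccontr)
  assume less: "\<not> Re z \<le> Re b"
  let ?B = "b \<cdot>\<^sub>m 1\<^sub>m n :: complex mat"
  have B: "?B \<in> carrier_mat n n" by simp
  note uU = eigenframesD[OF B fr]
  note U = unitary_matD[OF uU(1)]
  have conj: "mat_adjoint U * (c \<cdot>\<^sub>m 1\<^sub>m n) * U = c \<cdot>\<^sub>m 1\<^sub>m n" for c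
    using U by (simp add: mult_smult_distrib[of _ n n _ n] mult_smult_assoc_mat[of _ n n _ n])
  have herm: "herm_part ?B = complex_of_real (Re b) \<cdot>\<^sub>m 1\<^sub>m n"
    by (intro eq_matI) (auto simp: herm_part_def complex_eq_iff)
  have skew: "skew_part ?B = (\<i> * complex_of_real (Im b)) \<cdot>\<^sub>m 1\<^sub>m n"
    by (intro eq_matI) (auto simp: skew_part_def complex_eq_iff)
  have diag: "mat_adjoint U * herm_part ?B * U = mat_diag n (\<lambda>j. complex_of_real (Re b))"
    unfolding herm conj by (rule eq_matI) (auto simp: mat_diag_def)
  have delta: "delta ?B (Suc j) = Re b" if "j < n" for j
    using that by (intro eigenframesI(2)[OF B uU(1) diag]) (auto simp: monotone_on_def)
  have sk: "skew_conj ?B U = (\<i> * complex_of_real (Im b)) \<cdot>\<^sub>m 1\<^sub>m n"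
    unfolding skew_conj_def skew conj ..
  have W: "W_mat k ?B U z = (b - z) \<cdot>\<^sub>m 1\<^sub>m k"
    using k by (intro eq_matI) (auto simp: index_W_mat sk delta complex_eq_iff)
  have V: "V_block k ?B U = 0\<^sub>m (n - k) k"
    using k by (intro eq_matI) (auto simp: V_block_def sk)
  have "b - z \<noteq> 0" using less by auto
  then have "0 < (cmod (det (W_mat k ?B U z)))\<^sup>2"
    by (simp add: W)
  moreover have "(cmod (det (W_mat k ?B U z)))\<^sup>2 * (Re z - Re b) \<le> 0"
    using z by (simp add: mem_E_region_iff region_ineq_def V sigma1_zero[OF k(1)] delta[OF k(2)])
  ultimately show False using less by (simp add: mult_le_0_iff)
qed

section \<open>Intersection over all rotations\<close>

text \<open>
The construction chooses one frame for each angle in the half-open interval, while the operations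
act on the unit circle; this dictionary translates between the two.
\<close>

lemma cis_ex1:
  assumes "cmod w = 1"
  shows "\<exists>!t. t \<in> {0..<2 * pi} \<and> cis t = w"
proof (rule ex_ex1I)
  obtain s where s: "cis s = w" "- pi < s" "s \<le> pi"
    using cis_Arg[of w] Arg_bounded[of w] assms by (force simp: sgn_eq)
  show "\<exists>t. t \<in> {0..<2 * pi} \<and> cis t = w"
  proof (cases "0 \<le> s")
    case True
    moreover have "s < 2 * pi" using s(3) pi_gt_zero by linarith
    ultimately show ?thesis using s(1) by (intro exI[of _ s]) simp
  next
    case False
    then show ?thesis using s by (intro exI[of _ "s + 2 * pi"]) (auto simp: cis.code)
  qed
next
  fix s t assume st: "s \<in> {0..<2 * pi} \<and> cis s = w" "t \<in> {0..<2 * pi} \<and> cis t = w"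
  then have "cos s = cos t" "sin s = sin t" by (auto simp: complex_eq_iff)
  then obtain n :: int where n: "s = t + 2 * pi * n"
    using sin_cos_eq_iff[of s t] by (auto simp: mult_ac)
  then have "\<bar>2 * pi * n\<bar> < 2 * pi" using st by auto
  then have "2 * pi * \<bar>real_of_int n\<bar> < 2 * pi * 1" by (simp add: abs_mult)
  then have "\<bar>real_of_int n\<bar> < 1" using mult_less_cancel_left_pos[of "2 * pi"] pi_gt_zero by simp
  then have "n = 0" by linarith
  then show "s = t" using n by simp
qed

lemma mem_Ecal_iff:
  "z \<in> Ecal k A U \<longleftrightarrow> (\<forall>t\<in>{0..<2 * pi}. cis t * z \<in> E_region k (cis t \<cdot>\<^sub>m A) (U t))"
proof -
  have "z \<in> (\<lambda>z. cis (- t) * z) ` S \<longleftrightarrow> cis t * z \<in> S" for t S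
  proof
    assume "cis t * z \<in> S"
    then have "cis (- t) * (cis t * z) \<in> (\<lambda>z. cis (- t) * z) ` S" by blast
    then show "z \<in> (\<lambda>z. cis (- t) * z) ` S" by (simp add: cis_mult flip: mult.assoc)
  qed (auto simp: cis_mult simp flip: mult.assoc)
  then show ?thesis by (simp add: Ecal_def)
qed

text \<open>
The common pattern of the equivariance statements.  The rotation by \<open>w\<close> of the new matrix
\<open>A'\<close> corresponds to the rotation by \<open>\<rho> w\<close> of \<open>A\<close>, frames are mapped by \<open>\<Phi>\<close>, and points by \<open>f\<close>.  If the regions
match for each single rotation, so do their intersections, because \<open>\<rho>\<close> reaches all of the
circle.
\<close>

lemma Ecals_transport:
  assumes rho: "\<And>w. cmod w = 1 \<Longrightarrow> cmod (\<rho> w) = 1"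
    and onto: "\<And>v. cmod v = 1 \<Longrightarrow> \<exists>w. cmod w = 1 \<and> \<rho> w = v"
    and frame: "\<And>w U. cmod w = 1 \<Longrightarrow> U \<in> eigenframes (\<rho> w \<cdot>\<^sub>m A) \<Longrightarrow> \<Phi> U \<in> eigenframes (w \<cdot>\<^sub>m A')"
    and region: "\<And>w U z. cmod w = 1 \<Longrightarrow> U \<in> eigenframes (\<rho> w \<cdot>\<^sub>m A) \<Longrightarrow>
      w * f z \<in> E_region k (w \<cdot>\<^sub>m A') (\<Phi> U) \<longleftrightarrow> \<rho> w * z \<in> E_region k (\<rho> w \<cdot>\<^sub>m A) U"
    and f: "surj f"
    and F: "F \<in> Ecals k A"
  shows "f ` F \<in> Ecals k A'"
proof -
  let ?I = "{0..<2 * pi}"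
  obtain U where FU: "F = Ecal k A U" and U: "\<And>t. t \<in> ?I \<Longrightarrow> U t \<in> eigenframes (cis t \<cdot>\<^sub>m A)"
    using F by (auto simp: Ecals_def)
  \<comment> \<open>The angle of \<open>\<rho> (cis t)\<close>, so that a frame chosen for \<open>A\<close> can be reused at \<open>t\<close> for the new matrix.\<close>
  define \<tau> where "\<tau> t = (THE s. s \<in> ?I \<and> cis s = \<rho> (cis t))" for t
  have \<tau>: "\<tau> t \<in> ?I" "cis (\<tau> t) = \<rho> (cis t)" for t
    using theI'[OF cis_ex1[OF rho[OF norm_cis[of t]]]] by (auto simp: \<tau>_def)
  have \<tau>_onto: "\<exists>t\<in>?I. \<tau> t = s" if s: "s \<in> ?I" for s
  proof -
    obtain w where w: "cmod w = 1" "\<rho> w = cis s" using onto[OF norm_cis] by blast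
    obtain t where t: "t \<in> ?I" "cis t = w" using cis_ex1[OF w(1)] by blast
    then have "\<tau> t = s" using \<tau>[of t] w s cis_ex1[OF norm_cis[of s]] by metis
    then show ?thesis using t by blast
  qed
  define U' where "U' = (\<lambda>t. \<Phi> (U (\<tau> t)))"
  have fr: "U (\<tau> t) \<in> eigenframes (\<rho> (cis t) \<cdot>\<^sub>m A)" for t
    using U[OF \<tau>(1)] by (simp add: \<tau>(2))
  have "f z \<in> Ecal k A' U' \<longleftrightarrow> z \<in> F" for z
  proof -
    have "f z \<in> Ecal k A' U' \<longleftrightarrow> (\<forall>t\<in>?I. cis (\<tau> t) * z \<in> E_region k (cis (\<tau> t) \<cdot>\<^sub>m A) (U (\<tau> t)))"
      unfolding mem_Ecal_iff U'_def by (simp add: \<tau>(2) region[OF norm_cis fr])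
    also have "\<dots> \<longleftrightarrow> (\<forall>s\<in>?I. cis s * z \<in> E_region k (cis s \<cdot>\<^sub>m A) (U s))"
      using \<tau>(1) \<tau>_onto by metis
    finally show ?thesis by (simp add: FU mem_Ecal_iff)
  qed
  then have "f ` F = Ecal k A' U'"
    using f by (auto simp: surj_def image_iff) metis
  moreover have "U' t \<in> eigenframes (cis t \<cdot>\<^sub>m A')" for t
    unfolding U'_def by (rule frame[OF norm_cis fr])
  ultimately show ?thesis by (auto simp: Ecals_def)
qed

lemma Ecals_unitary_subset:
  assumes A: "A \<in> carrier_mat n n" and k: "k < n" and P: "unitary_mat n P"
  shows "Ecals k A \<subseteq> Ecals k (mat_adjoint P * A * P)"
proof
  note P' = unitary_matD[OF P]
  fix F assume F: "F \<in> Ecals k A"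
  have conj: "w \<cdot>\<^sub>m (mat_adjoint P * A * P) = mat_adjoint P * (w \<cdot>\<^sub>m A) * P" for w
    using A P' by (simp add: mult_smult_distrib[of _ n n _ n] mult_smult_assoc_mat[of _ n n _ n]
        mult_carrier_mat[of _ n n _ n])
  have wA: "w \<cdot>\<^sub>m A \<in> carrier_mat n n" for w using A by simp
  have "id ` F \<in> Ecals k (mat_adjoint P * A * P)"
    using E_region_unitary[OF wA P _ k]
    by (intro Ecals_transport[where \<rho> = id and \<Phi> = "\<lambda>U. mat_adjoint P * U", OF _ _ _ _ _ F])
      (auto simp: conj)
  then show "F \<in> Ecals k (mat_adjoint P * A * P)" by simp
qed

text \<open>
The converse inclusion is the same statement for the inverse operation.
\<close>

lemma Ecals_unitary:
  assumes A: "A \<in> carrier_mat n n" and k: "k < n" and P: "unitary_mat n P"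
  shows "Ecals k (mat_adjoint P * A * P) = Ecals k A"
proof
  note P' = unitary_matD[OF P]
  have "mat_adjoint (mat_adjoint P) * (mat_adjoint P * A * P) * mat_adjoint P
      = (P * mat_adjoint P) * A * (P * mat_adjoint P)"
    using A P'(1,2) by (simp add: assoc_mult_mat[of _ n n _ n _ n] mult_carrier_mat[of _ n n _ n])
  also have "\<dots> = A" using A P' by simp
  finally have undo: "mat_adjoint (mat_adjoint P) * (mat_adjoint P * A * P) * mat_adjoint P = A" .
  have "mat_adjoint P * A * P \<in> carrier_mat n n"
    using A P' by (simp add: mult_carrier_mat[of _ n n _ n])
  from Ecals_unitary_subset[OF this k unitary_mat_adjoint[OF P]]
  show "Ecals k (mat_adjoint P * A * P) \<subseteq> Ecals k A" by (simp only: undo)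
qed (rule Ecals_unitary_subset[OF assms])

lemma Ecals_transpose_subset:
  assumes A: "A \<in> carrier_mat n n" and k: "0 < k" "k < n"
  shows "Ecals k A \<subseteq> Ecals k (transpose_mat A)"
proof
  fix F assume F: "F \<in> Ecals k A"
  have conj: "w \<cdot>\<^sub>m transpose_mat A = transpose_mat (w \<cdot>\<^sub>m A)" for w
    by (rule eq_matI) auto
  have wA: "w \<cdot>\<^sub>m A \<in> carrier_mat n n" for w using A by simp
  have "id ` F \<in> Ecals k (transpose_mat A)"
    using E_region_transpose[OF wA _ k]
    by (intro Ecals_transport[where \<rho> = id and \<Phi> = "map_mat cnj", OF _ _ _ _ _ F])
      (auto simp: conj)
  then show "F \<in> Ecals k (transpose_mat A)" by simp
qed

lemma Ecals_transpose:
  assumes A: "A \<in> carrier_mat n n" and k: "0 < k" "k < n"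
  shows "Ecals k (transpose_mat A) = Ecals k A"
  using Ecals_transpose_subset[OF A k] Ecals_transpose_subset[of "transpose_mat A" n k] A k by auto

lemma Ecals_adjoint_subset:
  assumes A: "A \<in> carrier_mat n n" and k: "0 < k" "k < n" and F: "F \<in> Ecals k A"
  shows "cnj ` F \<in> Ecals k (mat_adjoint A)"
proof (rule Ecals_transport[where \<rho> = cnj and \<Phi> = id, OF _ _ _ _ _ F])
  have conj: "w \<cdot>\<^sub>m mat_adjoint A = mat_adjoint (cnj w \<cdot>\<^sub>m A)" for w
    by (simp add: mat_adjoint_smult)
  have wA: "w \<cdot>\<^sub>m A \<in> carrier_mat n n" for w using A by simp
  fix w U assume w: "cmod w = 1" and U: "U \<in> eigenframes (cnj w \<cdot>\<^sub>m A)"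
  note fwd = E_region_adjoint[OF wA U k]
  show "id U \<in> eigenframes (w \<cdot>\<^sub>m mat_adjoint A)"
    unfolding conj using fwd(1) by simp
  fix z
  have "mat_adjoint (cnj w \<cdot>\<^sub>m A) \<in> carrier_mat n n" using A by simp
  note bwd = E_region_adjoint(2)[OF this fwd(1) k]
  show "w * cnj z \<in> E_region k (w \<cdot>\<^sub>m mat_adjoint A) (id U) \<longleftrightarrow> cnj w * z \<in> E_region k (cnj w \<cdot>\<^sub>m A) U"
    unfolding conj using fwd(2)[of "cnj w * z"] bwd[of "w * cnj z"] by auto
qed (auto simp: surj_def intro: exI[of _ "cnj _"])

lemma Ecals_adjoint:
  assumes A: "A \<in> carrier_mat n n" and k: "0 < k" "k < n"
  shows "Ecals k (mat_adjoint A) = (\<lambda>F. cnj ` F) ` Ecals k A"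
proof
  show "Ecals k (mat_adjoint A) \<subseteq> (\<lambda>F. cnj ` F) ` Ecals k A"
  proof
    fix F assume F: "F \<in> Ecals k (mat_adjoint A)"
    then have "cnj ` F \<in> Ecals k A"
      using Ecals_adjoint_subset[of "mat_adjoint A" n k F] A k by simp
    moreover have "F = cnj ` cnj ` F" by (simp add: image_image)
    ultimately show "F \<in> (\<lambda>F. cnj ` F) ` Ecals k A" by blast
  qed
qed (use Ecals_adjoint_subset[OF A k] in blast)

text \<open>
Writing \<open>a = |a| sgn a\<close>, the phase of \<open>a\<close> is absorbed into the rotation, and what is left is
scaling by the positive number \<open>|a|\<close> and a translation.
\<close>

lemma Ecals_affine_subset:
  assumes A: "A \<in> carrier_mat n n" and k: "0 < k" "k < n" and a: "a \<noteq> 0" and F: "F \<in> Ecals k A"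
  shows "(\<lambda>z. a * z + b) ` F \<in> Ecals k (a \<cdot>\<^sub>m A + b \<cdot>\<^sub>m 1\<^sub>m n)"
proof (rule Ecals_transport[where \<rho> = "\<lambda>w. w * sgn a" and \<Phi> = id, OF _ _ _ _ _ F])
  have polar: "complex_of_real (cmod a) * sgn a = a"
    using a by (simp add: sgn_eq)
  have sgn1: "cmod (sgn a) = 1" using a by (simp add: norm_sgn)
  show "cmod (w * sgn a) = 1" if "cmod w = 1" for w
    using that sgn1 by (simp add: norm_mult)
  show "\<exists>w. cmod w = 1 \<and> w * sgn a = v" if "cmod v = 1" for v
    using that sgn1 a by (intro exI[of _ "v / sgn a"]) (auto simp: norm_divide sgn_zero_iff)
  show "surj (\<lambda>z. a * z + b)"
    unfolding surj_def
  proof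
    fix y
    have "y = a * ((y - b) / a) + b" using a by simp
    then show "\<exists>x. y = a * x + b" by blast
  qed
  have scale: "w * (a * z) = complex_of_real (cmod a) * (w * sgn a * z)" for w z
    by (subst (1) polar[symmetric]) (simp add: mult_ac)
  have conj: "w \<cdot>\<^sub>m (a \<cdot>\<^sub>m A + b \<cdot>\<^sub>m 1\<^sub>m n)
      = complex_of_real (cmod a) \<cdot>\<^sub>m ((w * sgn a) \<cdot>\<^sub>m A) + (w * b) \<cdot>\<^sub>m 1\<^sub>m n" for w
    using A by (intro eq_matI) (auto simp: distrib_left scale)
  have wA: "w \<cdot>\<^sub>m A \<in> carrier_mat n n" for w using A by simp
  have r: "0 < cmod a" using a by simp
  fix w U assume U: "U \<in> eigenframes ((w * sgn a) \<cdot>\<^sub>m A)"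
  note affine = E_region_affine[OF wA U k r, where b = "w * b"]
  show "id U \<in> eigenframes (w \<cdot>\<^sub>m (a \<cdot>\<^sub>m A + b \<cdot>\<^sub>m 1\<^sub>m n))"
    unfolding conj using affine(1) by simp
  show "w * (a * z + b) \<in> E_region k (w \<cdot>\<^sub>m (a \<cdot>\<^sub>m A + b \<cdot>\<^sub>m 1\<^sub>m n)) (id U)
      \<longleftrightarrow> w * sgn a * z \<in> E_region k ((w * sgn a) \<cdot>\<^sub>m A) U" for z
    unfolding conj id_apply
    using affine(2)[of "w * sgn a * z"] by (simp only: distrib_left[of w] scale)
qed

lemma spectrum_subset_Ecals:
  assumes A: "A \<in> carrier_mat n n" and k: "0 < k" "k < n" and F: "F \<in> Ecals k A"
  shows "spectrum A \<subseteq> F"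
proof
  fix z assume z: "z \<in> spectrum A"
  obtain U where FU: "F = Ecal k A U"
    and U: "\<And>t. t \<in> {0..<2 * pi} \<Longrightarrow> U t \<in> eigenframes (cis t \<cdot>\<^sub>m A)"
    using F by (auto simp: Ecals_def)
  have "cis t * z \<in> spectrum (cis t \<cdot>\<^sub>m A)" for t
    using z by (simp add: spectrum_smult[OF A])
  then show "z \<in> F"
    unfolding FU mem_Ecal_iff using A U k by (auto intro!: spectrum_subset_E_region[of _ n])
qed

lemma rank_numerical_range_subset_Ecals:
  assumes A: "A \<in> carrier_mat n n" and k: "0 < k" "k < n" and F: "F \<in> Ecals k A"
  shows "rank_numerical_range (Suc k) A \<subseteq> F"
proof
  fix z assume "z \<in> rank_numerical_range (Suc k) A"
  then obtain X where X: "X \<in> carrier_mat n (Suc k)" "mat_adjoint X * X = 1\<^sub>m (Suc k)"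
    "mat_adjoint X * A * X = z \<cdot>\<^sub>m 1\<^sub>m (Suc k)"
    using A by (auto simp: rank_numerical_range_def)
  obtain U where FU: "F = Ecal k A U"
    and U: "\<And>t. t \<in> {0..<2 * pi} \<Longrightarrow> U t \<in> eigenframes (cis t \<cdot>\<^sub>m A)"
    using F by (auto simp: Ecals_def)
  have wA: "w \<cdot>\<^sub>m A \<in> carrier_mat n n" for w using A by simp
  have "mat_adjoint X * (w \<cdot>\<^sub>m A) * X = w \<cdot>\<^sub>m (mat_adjoint X * A * X)" for w
    using X(1) A mult_carrier_mat[OF mat_adjoint_carrier[OF X(1)] A]
    by (simp add: mult_smult_distrib[OF mat_adjoint_carrier[OF X(1)] A] mult_smult_assoc_mat[OF _ X(1)])
  then have rot: "mat_adjoint X * (w \<cdot>\<^sub>m A) * X = (w * z) \<cdot>\<^sub>m 1\<^sub>m (Suc k)" for w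
    by (simp add: X(3)) (rule eq_matI, auto)
  have "cis t * z \<in> E_region k (cis t \<cdot>\<^sub>m A) (U t)" if t: "t \<in> {0..<2 * pi}" for t
  proof (rule halfplane_subset_E_region[OF wA _ k])
    show "U t \<in> carrier_mat n n"
      using unitary_matD(1)[OF eigenframesD(1)[OF wA U[OF t]]] .
    show "Re (cis t * z) \<le> delta (cis t \<cdot>\<^sub>m A) (Suc k)"
      by (rule compression_le_delta[OF wA U[OF t] k(2) X(1,2) rot])
  qed
  then show "z \<in> F" unfolding FU mem_Ecal_iff by blast
qed

lemma Ecals_nonempty:
  assumes A: "A \<in> carrier_mat n n"
  shows "Ecals k A \<noteq> {}"
proof -
  have "\<exists>U. U \<in> eigenframes (cis t \<cdot>\<^sub>m A)" for t
    using eigenframes_nonempty_delta_antimono(1)[of "cis t \<cdot>\<^sub>m A" n] A by auto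
  then obtain U where "\<And>t. U t \<in> eigenframes (cis t \<cdot>\<^sub>m A)" by metis
  then have "Ecal k A U \<in> Ecals k A" by (auto simp: Ecals_def)
  then show ?thesis by blast
qed

text \<open>
By the half-plane bound every member \<open>z\<close> satisfies \<open>Re (w (z - b)) \<le> 0\<close> for all \<open>w\<close> on the unit
circle, which forces \<open>z = b\<close>; conversely \<open>b\<close> is an eigenvalue.
\<close>

lemma Ecals_scalar:
  assumes k: "0 < k" "k < n"
  shows "Ecals k (b \<cdot>\<^sub>m 1\<^sub>m n) = {{b}}"
proof -
  have B: "b \<cdot>\<^sub>m 1\<^sub>m n \<in> carrier_mat n n" by simp
  have "F = {b}" if F: "F \<in> Ecals k (b \<cdot>\<^sub>m 1\<^sub>m n)" for F
  proof
    have "eigenvector (b \<cdot>\<^sub>m 1\<^sub>m n) (unit_vec n 0) b"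
      using k smult_mat_mult_vec[OF one_carrier_mat, of "unit_vec n 0" n b]
      by (simp add: eigenvector_def)
    then have "b \<in> spectrum (b \<cdot>\<^sub>m 1\<^sub>m n)" by (auto simp: spectrum_def eigenvalue_def)
    then show "{b} \<subseteq> F" using spectrum_subset_Ecals[OF B k F] by blast
    obtain U where FU: "F = Ecal k (b \<cdot>\<^sub>m 1\<^sub>m n) U"
      and U: "\<And>t. t \<in> {0..<2 * pi} \<Longrightarrow> U t \<in> eigenframes (cis t \<cdot>\<^sub>m (b \<cdot>\<^sub>m 1\<^sub>m n))"
      using F by (auto simp: Ecals_def)
    show "F \<subseteq> {b}"
    proof
      fix z assume z: "z \<in> F"
      show "z \<in> {b}"
      proof (rule ccontr)
        assume "z \<notin> {b}"
        then have nz: "z - b \<noteq> 0" by simp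
        then have "cmod (cnj (sgn (z - b))) = 1" by (simp add: norm_sgn)
        \<comment> \<open>The rotation that turns \<open>z - b\<close> into a positive number.\<close>
        then obtain t where t: "t \<in> {0..<2 * pi}" "cis t = cnj (sgn (z - b))"
          using cis_ex1 by blast
        have smult: "cis t \<cdot>\<^sub>m (b \<cdot>\<^sub>m 1\<^sub>m n) = (cis t * b) \<cdot>\<^sub>m 1\<^sub>m n"
          by (rule eq_matI) auto
        have "cis t * z \<in> E_region k (cis t \<cdot>\<^sub>m (b \<cdot>\<^sub>m 1\<^sub>m n)) (U t)"
          using z t(1) unfolding FU mem_Ecal_iff by blast
        then have "Re (cis t * z) \<le> Re (cis t * b)"
          using E_region_scalar_subset_halfplane[OF _ k] U[OF t(1)] unfolding smult by blast
        then have "Re (cis t * (z - b)) \<le> 0" by (simp add: algebra_simps)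
        moreover have "cis t * (z - b) = complex_of_real (cmod (z - b))"
        proof -
          have "sgn (z - b) * complex_of_real (cmod (z - b)) = z - b"
            using nz by (simp add: sgn_eq)
          then have "cis t * (z - b) = (sgn (z - b) * cnj (sgn (z - b))) * complex_of_real (cmod (z - b))"
            unfolding t(2) by (metis mult.assoc mult.commute)
          also have "sgn (z - b) * cnj (sgn (z - b)) = 1"
            using complex_norm_square[of "sgn (z - b)"] nz by (simp add: norm_sgn)
          finally show ?thesis by simp
        qed
        ultimately show False using nz by simp
      qed
    qed
  qed
  then show ?thesis using Ecals_nonempty[OF B, of k] by blast
qed

text \<open>
For \<open>a \<noteq> 0\<close> the inverse affine map gives the second inclusion.  For \<open>a = 0\<close> both sides are
\<open>{{b}}\<close>, since the family of regions of \<open>A\<close> and each of its members are nonempty.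
\<close>

lemma Ecals_affine:
  assumes A: "A \<in> carrier_mat n n" and k: "0 < k" "k < n"
  shows "Ecals k (a \<cdot>\<^sub>m A + b \<cdot>\<^sub>m 1\<^sub>m n) = (\<lambda>F. (\<lambda>z. a * z + b) ` F) ` Ecals k A"
proof (cases "a = 0")
  case True
  have "F \<noteq> {}" if "F \<in> Ecals k A" for F
    using spectrum_subset_Ecals[OF A k that] spectrum_non_empty[OF A] k by auto
  then have "(\<lambda>F. (\<lambda>z. a * z + b) ` F) ` Ecals k A = {{b}}"
    using Ecals_nonempty[OF A, of k] True by (auto simp: image_constant_conv image_def)
  moreover have "a \<cdot>\<^sub>m A + b \<cdot>\<^sub>m 1\<^sub>m n = b \<cdot>\<^sub>m 1\<^sub>m n"
    using A True by (intro eq_matI) auto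
  ultimately show ?thesis using Ecals_scalar[OF k] by simp
next
  case False
  let ?A = "a \<cdot>\<^sub>m A + b \<cdot>\<^sub>m 1\<^sub>m n"
  have A': "?A \<in> carrier_mat n n" using A by simp
  have inverse: "(1 / a) \<cdot>\<^sub>m ?A + (- b / a) \<cdot>\<^sub>m 1\<^sub>m n = A"
    using A False by (intro eq_matI) (auto simp: field_simps)
  have "F \<in> (\<lambda>F. (\<lambda>z. a * z + b) ` F) ` Ecals k A" if F: "F \<in> Ecals k ?A" for F
  proof -
    have "(\<lambda>z. 1 / a * z + - b / a) ` F \<in> Ecals k A"
      using Ecals_affine_subset[OF A' k _ F, of "1 / a" "- b / a"] False unfolding inverse by simp
    moreover have "F = (\<lambda>z. a * z + b) ` (\<lambda>z. 1 / a * z + - b / a) ` F"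
      using False by (simp add: image_image field_simps)
    ultimately show ?thesis by blast
  qed
  then show ?thesis using Ecals_affine_subset[OF A k False] by blast
qed

theorem proposition6:
  fixes A :: "complex mat" and n k :: nat
  assumes "A \<in> carrier_mat n n"
    and "1 \<le> k" and "k \<le> n - 1"
  shows "(\<forall>F\<in>Ecals k A. spectrum A \<subseteq> F)
    \<and> (\<forall>Ut. unitary_mat n Ut \<longrightarrow> Ecals k (mat_adjoint Ut * A * Ut) = Ecals k A)
    \<and> Ecals k (transpose_mat A) = Ecals k A
    \<and> Ecals k (mat_adjoint A) = (\<lambda>F. cnj ` F) ` Ecals k A
    \<and> (\<forall>a b. Ecals k (a \<cdot>\<^sub>m A + b \<cdot>\<^sub>m 1\<^sub>m n) = (\<lambda>F. (\<lambda>z. a * z + b) ` F) ` Ecals k A)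
    \<and> (\<forall>F\<in>Ecals k A. rank_numerical_range (k + 1) A \<subseteq> F)"
proof -
  have k: "0 < k" "k < n" using assms(2,3) by linarith+
  note * = assms(1) k
  show ?thesis
    by (intro conjI ballI allI impI spectrum_subset_Ecals[OF *] Ecals_unitary[OF assms(1) k(2)]
        Ecals_transpose[OF *] Ecals_adjoint[OF *] Ecals_affine[OF *]
        rank_numerical_range_subset_Ecals[OF *, unfolded Suc_eq_plus1])
qed

end
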